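(* Let $q$ be an odd prime power, let $G=\mathrm{PSL}_2(q)$ and let $n\ge 2$ be an integer. (i) If $q\equiv 3\pmod 4$, then $\Gamma_n(G)$ is strongly connected if and only if $n>a$, where $2^a$ is the largest power of $2$ dividing $(q+1)/2$. (ii) If $q\equiv 1\pmod 8$ and $q\ne 9$, then $\Gamma_2(G)$ is strongly connected. (iii) If $q=9$, then $\Gamma_n(G)$ is strongly connected if and only if $n\ge 3$. (iv) If $q\equiv 5\pmod 8$, then $\Gamma(G)$ is not strongly connected.
   Context: For elements $x,y$ of a group, $[x,y]=x^{-1}y^{-1}xy$, $[x,_0y]=x$ and $[x,_{i+1}y]=[[x,_iy],y]$ for $i\ge 0$. For a finite group $G$ and a positive integer $n$, let $I_n(G)=\{g\in G : [g,_nx]=1 \text{ and } [x,_ng]=1 \text{ for all } x\in G\}$. The $n$-th Engel graph $\Gamma_n(G)$ is the directed graph with vertex set $G\setminus I_n(G)$ in which $(x,y)$ is an arc if and only if $[x,_ny]=1$. The hypercenter of $G$ is $\mathbf{Z}_\infty(G)=\bigcup_{k\ge 0}\mathbf{Z}_k(G)$, where $\mathbf{Z}_0(G)=1$ and $\mathbf{Z}_{k+1}(G)/\mathbf{Z}_k(G)$ is the center of $G/\mathbf{Z}_k(G)$. The Engel graph $\Gamma(G)$ is the directed graph with vertex set $G\setminus\mathbf{Z}_\infty(G)$ in which $(x,y)$ is an arc if and only if $[x,_ny]=1$ for some positive integer $n$. A directed graph is strongly connected if for any two vertices there is a directed path from the first to the second.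
   Formalization: Part (i) additionally assumes q ≠ 3: for q = 3, PSL_2(3) = A_4 and a = 1, but no arc leads from a nonidentity element of the Klein four-subgroup to an element of order 3, so Γ_n(G) is not strongly connected for any n ≥ 2. *)

theory Defs
  imports
    "HOL-Algebra.Coset"
    "HOL-Analysis.Determinants"
    "HOL-Number_Theory.Prime_Powers"
    "Graph_Theory.Digraph_Component"
begin

definition group_comm :: "('a, 'b) monoid_scheme \<Rightarrow> 'a \<Rightarrow> 'a \<Rightarrow> 'a" where
  "group_comm G x y = inv\<^bsub>G\<^esub> x \<otimes>\<^bsub>G\<^esub> inv\<^bsub>G\<^esub> y \<otimes>\<^bsub>G\<^esub> x \<otimes>\<^bsub>G\<^esub> y"

primrec engel_comm :: "('a, 'b) monoid_scheme \<Rightarrow> 'a \<Rightarrow> nat \<Rightarrow> 'a \<Rightarrow> 'a" where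
  "engel_comm G x 0 y = x"
| "engel_comm G x (Suc i) y = group_comm G (engel_comm G x i y) y"

definition engel_isolated :: "('a, 'b) monoid_scheme \<Rightarrow> nat \<Rightarrow> 'a set" where
  "engel_isolated G n =
     {g \<in> carrier G. \<forall>x \<in> carrier G. engel_comm G g n x = \<one>\<^bsub>G\<^esub> \<and> engel_comm G x n g = \<one>\<^bsub>G\<^esub>}"

text \<open>An arc is the pair of its ends. Since \<open>[x, x] = 1\<close>, every vertex of the Engel graphs
  below carries a loop.\<close>

definition simple_digraph :: "'a set \<Rightarrow> ('a \<Rightarrow> 'a \<Rightarrow> bool) \<Rightarrow> ('a, 'a \<times> 'a) pre_digraph" where
  "simple_digraph V R =
     \<lparr>verts = V, arcs = {(x, y). x \<in> V \<and> y \<in> V \<and> R x y}, tail = fst, head = snd\<rparr>"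

definition nth_engel_graph ::
    "('a, 'b) monoid_scheme \<Rightarrow> nat \<Rightarrow> ('a, 'a \<times> 'a) pre_digraph" where
  "nth_engel_graph G n =
     simple_digraph (carrier G - engel_isolated G n) (\<lambda>x y. engel_comm G x n y = \<one>\<^bsub>G\<^esub>)"

definition group_center :: "('a, 'b) monoid_scheme \<Rightarrow> 'a set" where
  "group_center G = {z \<in> carrier G. \<forall>x \<in> carrier G. z \<otimes>\<^bsub>G\<^esub> x = x \<otimes>\<^bsub>G\<^esub> z}"

text \<open>\<open>upper_central G (Suc k)\<close> is the full preimage in \<open>G\<close> of the center of
  \<open>G Mod upper_central G k\<close>.\<close>

primrec upper_central :: "('a, 'b) monoid_scheme \<Rightarrow> nat \<Rightarrow> 'a set" where
  "upper_central G 0 = {\<one>\<^bsub>G\<^esub>}"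
| "upper_central G (Suc k) =
     {g \<in> carrier G. upper_central G k #>\<^bsub>G\<^esub> g \<in> group_center (G Mod upper_central G k)}"

definition hypercenter :: "('a, 'b) monoid_scheme \<Rightarrow> 'a set" where
  "hypercenter G = (\<Union>k. upper_central G k)"

definition engel_graph :: "('a, 'b) monoid_scheme \<Rightarrow> ('a, 'a \<times> 'a) pre_digraph" where
  "engel_graph G =
     simple_digraph (carrier G - hypercenter G)
       (\<lambda>x y. \<exists>n > 0. engel_comm G x n y = \<one>\<^bsub>G\<^esub>)"

text \<open>A finite field is determined up to isomorphism by its number of elements, so
  \<open>PSL2 :: ('a ^ 2 ^ 2) set monoid\<close> is \<open>PSL\<^sub>2(q)\<close> when \<open>'a\<close> is a finite field
  with \<open>CARD('a) = q\<close>. Its elements are the cosets of the center of \<open>SL2\<close>.\<close>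

definition SL2 :: "('a::field ^ 2 ^ 2) monoid" where
  "SL2 = \<lparr>carrier = {A. det A = 1}, monoid.mult = (**), one = mat 1\<rparr>"

definition PSL2 :: "('a::field ^ 2 ^ 2) set monoid" where
  "PSL2 = SL2 Mod group_center SL2"

end

(*
  Work in SL2 modulo sign.  If y is not an involution of PSL2, then [x,_n y] = 1 with n >= 2 holds
  iff y^x commutes with y, that is, iff x lies in the Borel subgroup (y unipotent) or in the
  normalizer of the torus (y semisimple) attached to y.  If y is an involution, [x,_n y] is up to
  inversion the 2^(n-1)-th power of [x,y], so x -> y is an arc iff [x,y] is trivial or its trace
  (tr x)^2 + (tr xy)^2 - 2 reaches 0 after fewer than n-1 iterations of t |-> t^2 - 2.  Hence a
  unipotent x can only leave its Sylow subgroup through an involution for which an iterate of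
  2 + d^2 vanishes, with d nonzero.  For q = 3 mod 4, writing 2 + d^2 = mu^2 + mu^(-2) with
  mu - 1/mu = d gives mu^(q+1) = -1, so that exactly a-1 iterations are needed; for q = 5 mod 8 no
  iterate vanishes since 2 is not a square.  Once unipotents can leave, every two involutions are
  joined through unipotents.  For q = 1 mod 8 an element of a nonsplit torus has to leave its torus
  as well; for n = 2 this needs some t with t^2 - 4 a nonsquare and 2 - t^2 a square.  The bound
  S^2 <= 4q for the Jacobsthal sum S of x(x^2 - 4) provides t when q > 9; for q = 9 there is none.
*)

theory Submission
  imports Defs "HOL-Algebra.Algebraic_Closure_Type" "HOL-Number_Theory.Residues"
begin

subsection \<open>Squares in finite fields of odd order\<close>

hide_const (open) Divisibility.prime

text \<open>Whether x -> y is an arc is governed by the conjugacy type of y, so leaving a class and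
  entering it are separate problems, each with its own paths. The obstacle is that iterated
  commutators are unwieldy words. For y of nonzero trace they are peeled off one at a time: [z,y] =
  c y, where c is the conjugate of y^(-1) by z, and since c again has the trace of y, the condition
  that the conjugate of y commutes with y descends from [z,y] to z. Trace zero must be set apart
  because there c can send y to its inverse without commuting with it, which is the anticommuting
  case of SL2.

  The type of a matrix A of determinant one is read off from (tr A)^2 - 4, so explicit entries and
  quadratic characters replace the subgroup classification of PSL2(q). Failure of connectivity is
  always shown by a proper set of vertices that no arc leaves: the upper unipotents, or, for q = 9
  and n = 2, the centralizer of an irreducible matrix.\<close>

definition square :: "'a::field \<Rightarrow> bool" where
  "square x \<longleftrightarrow> (\<exists>y. x = y ^ 2)"

lemma finite_field_power_pred:
  fixes x :: "'a::{field,finite}"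
  assumes "x \<noteq> 0"
  shows "x ^ (CARD('a) - 1) = 1"
proof -
  let ?U = "UNIV - {0 :: 'a}"
  have "(\<Prod>y\<in>?U. y) = (\<Prod>y\<in>?U. x * y)"
    by (rule prod.reindex_bij_witness[of _ "\<lambda>y. x * y" "\<lambda>y. y / x"]) (use assms in auto)
  also have "\<dots> = x ^ (CARD('a) - 1) * (\<Prod>y\<in>?U. y)"
    by (simp add: prod.distrib)
  finally show ?thesis
    by simp
qed

lemma finite_field_power_card:
  fixes x :: "'a::{field,finite}"
  shows "x ^ CARD('a) = x"
proof (cases "x = 0")
  case False
  have "x ^ CARD('a) = x * x ^ (CARD('a) - 1)"
    by (metis finite_UNIV_card_ge_0 finite power_eq_if not_gr_zero)
  with finite_field_power_pred[OF False] show ?thesis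
    by simp
qed simp

text \<open>Prepares the Frobenius map on the algebraic closure, and later the characteristic of the
  field with nine elements.\<close>

lemma card_power_CHAR:
  assumes "primepow CARD('a::{field,finite})"
  shows "prime CHAR('a)" "\<exists>k. CARD('a) = CHAR('a) ^ k"
proof -
  have "CHAR('a) > 0"
    by (simp add: finite_imp_CHAR_pos)
  then show p: "prime CHAR('a)"
    using prime_CHAR_semidom by auto
  obtain r k where rk: "prime r" "k > 0" "CARD('a) = r ^ k"
    using assms by (auto simp: primepow_def)
  have "CHAR('a) dvd r ^ k"
    using CHAR_dvd_CARD[where 'a='a] rk by simp
  with p rk have "CHAR('a) = r"
    by (metis prime_dvd_power primes_dvd_imp_eq)
  with rk show "\<exists>k. CARD('a) = CHAR('a) ^ k" by auto
qed

context
  assumes odd_card: "odd CARD('a::{field,finite})"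
begin

lemma two_neq_zero: "(2::'a) \<noteq> 0"
proof
  assume "(2::'a) = 0"
  then have "CHAR('a) dvd 2"
    by (metis of_nat_eq_0_iff_char_dvd of_nat_numeral)
  moreover have "CHAR('a) \<noteq> 1"
    by simp
  ultimately have "CHAR('a) = 2"
    by (metis prime_nat_iff two_is_prime_nat)
  with odd_card CHAR_dvd_CARD[where 'a='a] show False
    by simp
qed

lemma card_nonzero_squares: "card {x::'a. x \<noteq> 0 \<and> square x} = (CARD('a) - 1) div 2"
proof -
  let ?S = "{x::'a. x \<noteq> 0 \<and> square x}"
  have "UNIV - {0::'a} = (\<Union>s\<in>?S. {y. y ^ 2 = s})"
    by (auto simp: square_def)
  then have "CARD('a) - 1 = card (\<Union>s\<in>?S. {y. y ^ 2 = s})"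
    by (metis card_Diff_singleton UNIV_I)
  also have "\<dots> = (\<Sum>s\<in>?S. card {y. y ^ 2 = s})"
    by (rule card_UN_disjoint) auto
  also have "\<dots> = (\<Sum>s\<in>?S. 2)"
  proof (rule sum.cong)
    fix s :: 'a assume "s \<in> ?S"
    then obtain z where z: "s = z ^ 2" "z \<noteq> 0"
      by (auto simp: square_def)
    have "z \<noteq> - z"
      using z(2) two_neq_zero by (metis add.right_inverse mult_2 mult_eq_0_iff)
    moreover have "{y. y ^ 2 = s} = {z, - z}"
      using z by (auto simp: power2_eq_iff)
    ultimately show "card {y. y ^ 2 = s} = 2"
      by simp
  qed simp
  finally show ?thesis
    by simp
qed

text \<open>The polynomial X^h - 1 has at most \<open>h\<close> roots and the \<open>h\<close>
  nonzero squares are roots already. A nonsquare therefore yields the other square root of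
  1.\<close>

lemma euler_criterion_field:
  assumes "(x::'a) \<noteq> 0"
  shows "x ^ ((CARD('a) - 1) div 2) = (if square x then 1 else - 1)"
proof -
  define h where "h = (CARD('a) - 1) div 2"
  have "CARD('a) > 1"
    using card_mono[of "UNIV :: 'a set" "{0, 1}"] by simp
  then have h: "h > 0" "CARD('a) - 1 = 2 * h"
    using odd_card unfolding h_def by (auto elim!: oddE)
  let ?p = "monom 1 h - 1 :: 'a poly"
  have deg: "degree ?p \<le> h"
    by (rule degree_diff_le) (simp_all add: degree_monom_le)
  have "coeff ?p h = 1"
    using h by simp
  then have p0: "?p \<noteq> 0"
    by (metis coeff_0 zero_neq_one)
  have sq: "{x::'a. x \<noteq> 0 \<and> square x} \<subseteq> {x. poly ?p x = 0}"
  proof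
    fix x :: 'a assume "x \<in> {x. x \<noteq> 0 \<and> square x}"
    then obtain z where "x = z ^ 2" "z \<noteq> 0"
      by (auto simp: square_def)
    then show "x \<in> {x. poly ?p x = 0}"
      using finite_field_power_pred[of z, unfolded h(2)] by (simp add: poly_monom power_mult)
  qed
  have "card {x. poly ?p x = 0} \<le> h"
    using card_poly_roots_bound[OF p0] deg by linarith
  then have eq: "{x::'a. x \<noteq> 0 \<and> square x} = {x. poly ?p x = 0}"
    using sq card_nonzero_squares unfolding h_def by (intro card_seteq) (auto simp: poly_roots_finite[OF p0])
  have "(x ^ h) ^ 2 = 1"
    using finite_field_power_pred[OF assms, unfolded h(2)] by (simp add: mult.commute flip: power_mult)
  then have "x ^ h = 1 \<or> x ^ h = - 1"
    by (simp add: power2_eq_1_iff)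
  moreover have "x ^ h = 1 \<longleftrightarrow> square x"
    using eq assms by (auto simp: poly_monom set_eq_iff)
  ultimately show ?thesis
    by (auto simp: h_def)
qed

lemma square_mult_iff:
  assumes "(x::'a) \<noteq> 0" "y \<noteq> 0"
  shows "square (x * y) \<longleftrightarrow> (square x \<longleftrightarrow> square y)"
proof -
  have "(1::'a) \<noteq> - 1"
    using two_neq_zero by (metis one_add_one add.right_inverse)
  moreover have "(if square (x * y) then 1 else - 1) =
      (if square x then 1 else - 1) * (if square y then 1 else - 1 :: 'a)"
    using assms by (simp only: euler_criterion_field[symmetric] mult_eq_0_iff simp_thms power_mult_distrib)
  ultimately show ?thesis
    by (auto split: if_splits)
qed

lemma square_minus_one_iff: "square (- 1 :: 'a) \<longleftrightarrow> CARD('a) mod 4 = 1"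
proof -
  have "(1::'a) \<noteq> - 1"
    using two_neq_zero by (metis one_add_one add.right_inverse)
  moreover have "even ((CARD('a) - 1) div 2) \<longleftrightarrow> CARD('a) mod 4 = 1"
    using odd_card by presburger
  ultimately show ?thesis
    using euler_criterion_field[of "- 1"] by (auto simp: minus_one_power_iff split: if_splits)
qed

lemma ex_nonsquare: "\<exists>x::'a. \<not> square x"
proof (rule ccontr)
  assume "\<not> ?thesis"
  then have "{x::'a. x \<noteq> 0 \<and> square x} = UNIV - {0}"
    by auto
  then have "(CARD('a) - 1) div 2 = CARD('a) - 1"
    by (metis card_nonzero_squares card_Diff_singleton UNIV_I)
  moreover have "CARD('a) \<ge> 3"
    using odd_card card_mono[of "UNIV :: 'a set" "{0, 1}"] by auto presburger
  ultimately show False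
    by simp
qed

lemma square_two_if_mod_8_eq_1:
  assumes "CARD('a) mod 8 = 1"
  shows "square (2::'a)"
proof -
  obtain g :: 'a where g: "\<not> square g"
    using ex_nonsquare by blast
  then have g0: "g \<noteq> 0"
    by (auto simp: square_def)
  \<comment> \<open>A primitive eighth root of unity: z^4 = -1, hence (z + 1/z)^2 = z^2 + z^(-2) + 2
    = 2.\<close>
  define z where "z = g ^ ((CARD('a) - 1) div 8)"
  have "(CARD('a) - 1) div 8 * 4 = (CARD('a) - 1) div 2"
    using assms by presburger
  then have "z ^ 4 = - 1"
    using euler_criterion_field[OF g0] g by (simp add: z_def flip: power_mult)
  moreover have "z \<noteq> 0"
    using g0 by (simp add: z_def)
  ultimately have "(z + 1 / z) ^ 2 = 2"
    by (simp add: field_simps) (simp add: power2_eq_square eval_nat_numeral algebra_simps)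
  then show ?thesis
    by (metis square_def)
qed

text \<open>If i^2 = -1, then (1 + i)^2 = 2 i, so with 2 also \<open>i\<close> would be a square.
  Its square root would have order 8, which does not divide q - 1.\<close>

lemma not_square_two_if_mod_8_eq_5:
  assumes "CARD('a) mod 8 = 5"
  shows "\<not> square (2::'a)"
proof
  assume "square (2::'a)"
  have "CARD('a) mod 4 = 1"
    using assms by presburger
  then obtain i :: 'a where i: "i ^ 2 = - 1"
    using square_minus_one_iff by (auto simp: square_def)
  then have "i \<noteq> 0"
    by auto
  have "(1 + i) ^ 2 = 2 * i"
    using i by (simp add: power2_eq_square algebra_simps)
  then have "square (2 * i)"
    by (metis square_def)
  then have "square i"
    using \<open>square 2\<close> \<open>i \<noteq> 0\<close> two_neq_zero by (simp add: square_mult_iff)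
  then obtain x where x: "i = x ^ 2"
    by (auto simp: square_def)
  have "CARD('a) - 1 = 4 * ((CARD('a) - 1) div 4)" "odd ((CARD('a) - 1) div 4)"
    using assms by presburger+
  then have "x ^ (CARD('a) - 1) = ((x ^ 2) ^ 2) ^ ((CARD('a) - 1) div 4)"
    by (metis mult_2 numeral_Bit0 power_mult power_add power2_eq_square)
  also have "\<dots> = - 1"
    using x i \<open>odd ((CARD('a) - 1) div 4)\<close> by simp
  finally show False
    using finite_field_power_pred[of x] x \<open>i \<noteq> 0\<close> two_neq_zero
    by (metis one_add_one add.right_inverse zero_power2)
qed

end

subsection \<open>Iterating the trace of a square\<close>

text \<open>The trace of the square of a matrix with determinant one and trace \<open>t\<close>. On
  t = m + 1/m it acts by squaring m.\<close>

definition trace_sq :: "'a::field \<Rightarrow> 'a" where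
  "trace_sq t = t ^ 2 - 2"

lemma trace_sq_iter_two: "(trace_sq ^^ i) 2 = 2"
  by (induction i) (simp_all add: trace_sq_def)

lemma trace_sq_iter_minus_two: "(trace_sq ^^ i) (- 2) \<in> {2, - 2}"
  by (induction i) (auto simp: trace_sq_def)

lemma trace_sq_iter_minus:
  assumes "(trace_sq ^^ i) t = 0"
  shows "(trace_sq ^^ i) (- t) = 0"
  using assms by (cases i) (simp_all add: funpow_swap1 trace_sq_def del: funpow.simps(2) add: funpow_Suc_right)

text \<open>The orbit of 0 continues -2, 2, 2, ..., so an orbit meets 0 at most once when 2 is
  nonzero.\<close>

lemma trace_sq_iter_inj:
  assumes "(2::'a::field) \<noteq> 0" "(trace_sq ^^ j) (t::'a) = 0" "(trace_sq ^^ k) t = 0"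
  shows "j = k"
proof -
  have False if "(trace_sq ^^ j) t = 0" "(trace_sq ^^ k) t = 0" "j < k" for j k
  proof -
    from \<open>j < k\<close> obtain m where "k = Suc m + j"
      by (metis add.commute add_Suc_right less_iff_Suc_add)
    with that(1,2) have "(trace_sq ^^ Suc m) 0 = (0::'a)"
      by (metis comp_apply funpow_add)
    then have "(trace_sq ^^ m) (- 2) = (0::'a)"
      by (simp add: funpow_Suc_right trace_sq_def del: funpow.simps(2))
    then show False
      using trace_sq_iter_minus_two[of m, where 'a='a] assms(1) by auto
  qed
  then show ?thesis
    using assms by (metis linorder_neqE_nat)
qed

text \<open>Otherwise every \<open>t\<close> whose orbit meets 0 would have \<open>t + 2\<close> a
  square: if not, then -t - 2 = d^2 because -1 is a nonsquare, and the orbit of -t = 2 + d^2 meets 0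
  as well. So each such \<open>t\<close> would have a preimage s with s^2 = t + 2, and backward
  orbits of 0 could be prolonged forever. Their points are pairwise distinct, contradicting
  finiteness.\<close>

lemma ex_trace_sq_iter_zero:
  assumes "CARD('a::{field,finite}) mod 4 = 3"
  shows "\<exists>i d::'a. (trace_sq ^^ i) (2 + d ^ 2) = 0"
proof (rule ccontr)
  assume none: "\<not> ?thesis"
  have odd: "odd CARD('a)"
    using assms by presburger
  have sq: "square (t + 2)" if "(trace_sq ^^ i) t = 0" for i and t :: 'a
  proof (rule ccontr)
    assume ns: "\<not> square (t + 2)"
    then have "t + 2 \<noteq> 0"
      by (auto simp: square_def)
    then have "square (- 1 * (t + 2))"
      using square_mult_iff[OF odd, of "- 1" "t + 2"] square_minus_one_iff[OF odd] ns assms by simp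
    then obtain d where "- t - 2 = d ^ 2"
      by (auto simp: square_def)
    then have "- t = 2 + d ^ 2"
      by (simp add: algebra_simps)
    then show False
      using none trace_sq_iter_minus[OF that] by metis
  qed
  have ex: "\<exists>t::'a. (trace_sq ^^ k) t = 0" for k
  proof (induction k)
    case (Suc k)
    then obtain t :: 'a where t: "(trace_sq ^^ k) t = 0" by blast
    from sq[OF this] obtain s where "t + 2 = s ^ 2"
      by (auto simp: square_def)
    then have "trace_sq s = t"
      by (simp add: trace_sq_def flip: \<open>t + 2 = s ^ 2\<close>)
    with t show ?case
      by (metis comp_apply funpow_Suc_right)
  qed auto
  then obtain T :: "nat \<Rightarrow> 'a" where T: "(trace_sq ^^ k) (T k) = 0" for k
    by metis
  have "inj T"
    by (rule injI) (metis T trace_sq_iter_inj two_neq_zero[OF odd])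
  then show False
    using finite_imageD[of T UNIV] by simp
qed

text \<open>The element \<open>z\<close> with z - 1/z = d lives in the algebraic closure, and
  Frobenius must send it to the other root -1/z of its quadratic equation. Then z^(2^(i+2)) and
  z^(q+1) are both -1, which forces the 2-part of q + 1 to be 2^(i+2).\<close>

lemma trace_sq_iter_zero_imp_multiplicity:
  assumes pp: "primepow CARD('a::{field,finite})" and mod4: "CARD('a) mod 4 = 3"
    and zero: "(trace_sq ^^ i) (2 + d ^ 2) = (0::'a)"
  shows "multiplicity 2 ((CARD('a) + 1) div 2) = Suc i"
proof -
  define q where "q = CARD('a)"
  have odd: "odd CARD('a)"
    using mod4 by presburger
  define D where "D = to_ac d"
  have "degree [:- 1, - D, 1:] > 0"
    by simp
  then obtain z where "poly [:- 1, - D, 1:] z = 0"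
    using alg_closed_imp_poly_has_root by blast
  then have z: "z ^ 2 = D * z + 1"
    by (simp add: power2_eq_square algebra_simps)
  then have z0: "z \<noteq> 0"
    by auto
  have neg1: "(1::'a alg_closure) \<noteq> - 1"
    using two_neq_zero[OF odd]
    by (metis one_add_one add.right_inverse to_ac_numeral to_ac_eq_0_iff)
  \<comment> \<open>The k-th iterate is m + 1/m with m = z^(2^(k+1)); the denominator is
    cleared.\<close>
  have iter: "to_ac ((trace_sq ^^ k) (2 + d ^ 2)) * z ^ 2 ^ Suc k = z ^ 2 ^ Suc (Suc k) + 1" for k
  proof (induction k)
    case 0
    have "(2 + D ^ 2) * z ^ 2 = (z ^ 2) ^ 2 + 1 \<longleftrightarrow> (D * z) ^ 2 = (z ^ 2 - 1) ^ 2"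
      by (simp add: power2_eq_square algebra_simps)
    also have "\<dots>"
      by (simp add: z)
    finally show ?case
      by (simp add: D_def flip: power_mult)
  next
    case (Suc k)
    define t where "t = to_ac ((trace_sq ^^ k) (2 + d ^ 2))"
    define m where "m = z ^ 2 ^ Suc k"
    have m2: "z ^ 2 ^ Suc (Suc k) = m ^ 2" "z ^ 2 ^ Suc (Suc (Suc k)) = (m ^ 2) ^ 2"
      by (simp_all add: m_def mult_ac flip: power_mult)
    have tm: "t * m = m ^ 2 + 1"
      using Suc by (simp only: m2) (simp add: t_def m_def)
    have "(t ^ 2 - 2) * m ^ 2 = (t * m) ^ 2 - 2 * m ^ 2"
      by (simp add: power2_eq_square algebra_simps)
    also have "\<dots> = (m ^ 2) ^ 2 + 1"
      unfolding tm by (simp add: power2_eq_square algebra_simps)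
    finally show ?case
      unfolding m2 by (simp add: trace_sq_def[of "(trace_sq ^^ k) _"] t_def)
  qed
  define e where "e = (2::nat) ^ (i + 2)"
  have e: "z ^ e = - 1"
    using iter[of i] zero by (simp add: e_def eq_neg_iff_add_eq_0)
  obtain k where k: "q = CHAR('a) ^ k"
    using card_power_CHAR(2)[OF pp] by (auto simp: q_def)
  define r where "r = z ^ q"
  have Dq: "D ^ q = D"
    by (simp add: D_def q_def finite_field_power_card flip: to_ac_power)
  have "r ^ 2 = (D * z + 1) ^ q"
    by (simp add: r_def mult.commute flip: power_mult z)
  also have "\<dots> = (D * z) ^ q + 1 ^ q"
    by (rule freshmans_dream'[of q k]) (simp_all add: card_power_CHAR(1)[OF pp] k)
  also have "\<dots> = D * r + 1"
    by (simp add: Dq r_def power_mult_distrib)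
  finally have r: "r ^ 2 = D * r + 1" .
  \<comment> \<open>\<open>r\<close> and \<open>z\<close> satisfy the same quadratic equation with
    constant term -1, so they are equal or have product -1.\<close>
  have "(r - z) * (r * z + 1) = r ^ 2 * z + r - r * z ^ 2 - z"
    by (simp add: power2_eq_square algebra_simps)
  also have "\<dots> = 0"
    unfolding r z by (simp add: algebra_simps)
  finally have "(r - z) * (r * z + 1) = 0" .
  then have "r = z \<or> r * z = - 1"
    by (auto simp: eq_neg_iff_add_eq_0)
  moreover have "r \<noteq> z"
  proof
    assume "r = z"
    have q1: "q = Suc (q - 1)"
      using mod4 by (simp add: q_def)
    then have "z * z ^ (q - 1) = z"
      using \<open>r = z\<close> unfolding r_def by (metis power_Suc)
    then have one: "z ^ (q - 1) = 1"
      using z0 by simp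
    \<comment> \<open>Here q = 3 mod 4 enters: an odd power of z^e = -1 has an exponent divisible by
      q - 1, and so would be 1.\<close>
    have "\<exists>j. q - 1 = 2 * (2 * j + 1)"
      using mod4 unfolding q_def by presburger
    then obtain j where j: "q - 1 = 2 * (2 * j + 1)" ..
    have "(z ^ e) ^ (2 * j + 1) = (z ^ (q - 1)) ^ (2 ^ (i + 1))"
      unfolding e_def j power_mult[symmetric] by (rule arg_cong[of _ _ "\<lambda>m. z ^ m"]) simp
    then show False
      using e one neg1 by simp
  qed
  ultimately have minus: "z ^ (q + 1) = - 1"
    by (simp add: r_def mult.commute)
  define m where "m = multiplicity 2 ((q + 1) div 2)"
  obtain w where w: "(q + 1) div 2 = 2 ^ m * w" "odd w"
    unfolding m_def by (rule multiplicity_decompose'[of "(q + 1) div 2" 2]) (use mod4 in \<open>auto simp: q_def\<close>)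
  have qw: "q + 1 = 2 ^ Suc m * w"
    using w(1) odd dvd_mult_div_cancel[of 2 "q + 1"] by (simp add: q_def)
  \<comment> \<open>If the 2-parts of \<open>e\<close> and \<open>q + 1\<close> differed, an even
    power of -1 would meet -1 or an odd power of it.\<close>
  have "\<not> Suc i < m"
  proof
    assume "Suc i < m"
    then have "(2::nat) ^ Suc m = e * 2 ^ (m - Suc i)"
      unfolding e_def power_add[symmetric] by (intro arg_cong[of _ _ "\<lambda>m. 2 ^ m"]) simp
    then have "z ^ (q + 1) = ((z ^ e) ^ 2 ^ (m - Suc i)) ^ w"
      by (simp only: qw power_mult)
    also have "\<dots> = 1"
      using \<open>Suc i < m\<close> by (simp add: e)
    finally show False
      using minus neg1 by simp
  qed
  moreover have "\<not> m < Suc i"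
  proof
    assume "m < Suc i"
    then have "e = 2 ^ Suc m * 2 ^ (Suc i - m)"
      unfolding e_def power_add[symmetric] by (intro arg_cong[of _ _ "\<lambda>m. 2 ^ m"]) simp
    then have "(z ^ e) ^ w = (z ^ (q + 1)) ^ 2 ^ (Suc i - m)"
      by (simp only: qw mult_ac flip: power_mult)
    then have "(- 1) ^ w = (- 1 :: 'a alg_closure) ^ 2 ^ (Suc i - m)"
      by (simp only: minus e)
    then show False
      using \<open>m < Suc i\<close> \<open>odd w\<close> neg1 by simp
  qed
  ultimately show ?thesis
    by (simp add: m_def q_def)
qed

subsection \<open>A Jacobsthal sum\<close>

text \<open>The quadratic character with integer values, so that sums over the field can be
  estimated.\<close>

definition quad_char :: "'a::field \<Rightarrow> int" where
  "quad_char x = (if x = 0 then 0 else if square x then 1 else - 1)"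

lemma quad_char_0 [simp]: "quad_char 0 = 0"
  by (simp add: quad_char_def)

lemma quad_char_eq_0_iff [simp]: "quad_char x = 0 \<longleftrightarrow> x = 0"
  by (simp add: quad_char_def)

lemma square_power2 [simp]: "square (x ^ 2)"
  by (auto simp: square_def)

lemma quad_char_power2: "quad_char (x ^ 2) = (if x = 0 then 0 else 1)"
  by (simp add: quad_char_def)

context
  assumes odd_card: "odd CARD('a::{field,finite})"
begin

lemma quad_char_mult: "quad_char (x * y :: 'a) = quad_char x * quad_char y"
  by (simp add: quad_char_def square_mult_iff[OF odd_card])

lemma sum_quad_char: "(\<Sum>x\<in>UNIV. quad_char (x::'a)) = 0"
proof -
  obtain n :: 'a where n: "\<not> square n"
    using ex_nonsquare[OF odd_card] by blast
  then have n0: "n \<noteq> 0"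
    by (auto simp: square_def)
  have "(\<Sum>x\<in>UNIV. quad_char (x::'a)) = (\<Sum>x\<in>UNIV. quad_char (n * x))"
    by (rule sum.reindex_bij_witness[of _ "\<lambda>x. n * x" "\<lambda>x. x / n"]) (use n0 in auto)
  also have "\<dots> = - (\<Sum>x\<in>UNIV. quad_char (x::'a))"
    using n n0 quad_char_def[of n] by (simp add: quad_char_mult sum_negf)
  finally show ?thesis
    by simp
qed

lemma sum_quad_char_shift: "(\<Sum>x\<in>UNIV. quad_char (x + b :: 'a)) = 0"
proof -
  have "(\<Sum>x\<in>UNIV. quad_char (x + b)) = (\<Sum>x\<in>UNIV. quad_char (x::'a))"
    by (rule sum.reindex_bij_witness[of _ "\<lambda>x. x - b" "\<lambda>x. x + b"]) auto
  then show ?thesis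
    by (simp add: sum_quad_char)
qed

text \<open>For distinct roots, shift to a (a + d) and divide by the square a^2: what remains is 1 +
  d/a, which runs over everything except 1.\<close>

lemma sum_quad_char_quadratic:
  "(\<Sum>a\<in>UNIV. quad_char ((a + b) * (a + c) :: 'a)) = (if b = c then int CARD('a) - 1 else - 1)"
proof (cases "b = c")
  case True
  have "(\<Sum>a\<in>UNIV. quad_char ((a + b) * (a + c) :: 'a)) = (\<Sum>a\<in>UNIV - {- b}. 1)"
    by (rule sum.mono_neutral_cong_right)
      (auto simp: True eq_neg_iff_add_eq_0 quad_char_power2 simp flip: power2_eq_square)
  then show ?thesis
    using True by (simp add: card_Diff_singleton of_nat_diff Suc_leI finite_UNIV_card_ge_0)
next
  case False
  define d where "d = c - b"
  have d: "d \<noteq> 0"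
    using False by (simp add: d_def)
  have "(\<Sum>a\<in>UNIV. quad_char ((a + b) * (a + c) :: 'a)) = (\<Sum>a\<in>UNIV. quad_char (a * (a + d)))"
    by (rule sum.reindex_bij_witness[of _ "\<lambda>x. x - b" "\<lambda>x. x + b"]) (auto simp: d_def)
  also have "\<dots> = (\<Sum>a\<in>UNIV - {0}. quad_char (a * (a + d)))"
    by (rule sum.mono_neutral_right) auto
  also have "\<dots> = (\<Sum>a\<in>UNIV - {1 :: 'a}. quad_char a)"
  proof (rule sum.reindex_bij_witness[of _ "\<lambda>x. d / (x - 1)" "\<lambda>x. 1 + d / x"])
    fix a :: 'a assume "a \<in> UNIV - {0}"
    then have "a * (a + d) = a ^ 2 * (1 + d / a)" "a \<noteq> 0"
      by (auto simp: field_simps power2_eq_square)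
    then show "quad_char (1 + d / a) = quad_char (a * (a + d))"
      by (simp only: quad_char_mult quad_char_power2) simp
  qed (use d in \<open>auto simp: field_simps\<close>)
  also have "\<dots> = (\<Sum>a\<in>UNIV. quad_char (a::'a)) - quad_char (1::'a)"
    by (simp add: sum_diff1)
  also have "\<dots> = - 1"
    using quad_char_power2[of "1::'a"] by (simp add: sum_quad_char)
  finally show ?thesis
    using False by simp
qed

text \<open>For nonzero \<open>a\<close> this is minus the Frobenius trace of the elliptic curve y^2
  = x^3 - a x.\<close>

definition jacobsthal :: "'a \<Rightarrow> int" where
  "jacobsthal a = (\<Sum>x\<in>UNIV. quad_char (x * (x ^ 2 - a)))"

text \<open>Substituting c x for x changes the sum only by the sign of c^3.\<close>

lemma jacobsthal_mult_power2:
  assumes "c \<noteq> 0"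
  shows "(jacobsthal (a * c ^ 2)) ^ 2 = (jacobsthal a) ^ 2"
proof -
  have "jacobsthal (a * c ^ 2) = (\<Sum>x\<in>UNIV. quad_char ((c * x) * ((c * x) ^ 2 - a * c ^ 2)))"
    unfolding jacobsthal_def
    by (rule sum.reindex_bij_witness[of _ "\<lambda>x. c * x" "\<lambda>x. x / c"]) (use assms in auto)
  also have "\<dots> = (\<Sum>x\<in>UNIV. quad_char (c * c ^ 2) * quad_char (x * (x ^ 2 - a)))"
    unfolding quad_char_mult[symmetric]
    by (intro sum.cong refl arg_cong[of _ _ quad_char]) (simp add: power2_eq_square algebra_simps)
  also have "\<dots> = quad_char (c * c ^ 2) * jacobsthal a"
    by (simp add: jacobsthal_def sum_distrib_left)
  finally show ?thesis
    using assms by (simp add: quad_char_def power_mult_distrib)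
qed

text \<open>Second moment: expand the square and sum over \<open>a\<close> first. The constant -1 of
  the inner sum contributes a product of vanishing sums, and only y = x and y = -x survive; both
  count positively since -1 is a square.\<close>

lemma sum_jacobsthal_power2:
  assumes "square (- 1 :: 'a)"
  shows "(\<Sum>a\<in>UNIV. (jacobsthal a) ^ 2) = 2 * int CARD('a) * (int CARD('a) - 1)"
proof -
  let ?q = "int CARD('a)"
  have "(\<Sum>a\<in>UNIV. (jacobsthal a) ^ 2) =
      (\<Sum>a\<in>UNIV. \<Sum>x\<in>UNIV. \<Sum>y\<in>UNIV. quad_char (x * y :: 'a) * quad_char ((a + - (x ^ 2)) * (a + - (y ^ 2))))"
    unfolding jacobsthal_def power2_eq_square[of "sum _ _"] sum_product
    unfolding quad_char_mult[symmetric]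
    by (intro sum.cong refl arg_cong[of _ _ quad_char]) (simp add: algebra_simps)
  also have "\<dots> = (\<Sum>x\<in>UNIV. \<Sum>a\<in>UNIV. \<Sum>y\<in>UNIV. quad_char (x * y :: 'a) * quad_char ((a + - (x ^ 2)) * (a + - (y ^ 2))))"
    by (rule sum.swap)
  also have "\<dots> = (\<Sum>x\<in>UNIV. \<Sum>y\<in>UNIV. \<Sum>a\<in>UNIV. quad_char (x * y :: 'a) * quad_char ((a + - (x ^ 2)) * (a + - (y ^ 2))))"
    by (intro sum.cong refl sum.swap)
  also have "\<dots> = (\<Sum>x\<in>UNIV. \<Sum>y\<in>UNIV. quad_char (x * y :: 'a) * (if x ^ 2 = y ^ 2 then ?q - 1 else - 1))"
    by (simp only: sum_distrib_left[symmetric] sum_quad_char_quadratic neg_equal_iff_equal)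
  also have "\<dots> = (\<Sum>x\<in>UNIV. \<Sum>y\<in>UNIV. ((if x ^ 2 = y ^ 2 then ?q * quad_char (x * y :: 'a) else 0) - quad_char x * quad_char y))"
    by (intro sum.cong refl) (simp add: algebra_simps quad_char_mult)
  also have "\<dots> = (\<Sum>x\<in>UNIV. \<Sum>y\<in>UNIV. (if x ^ 2 = y ^ 2 then ?q * quad_char (x * y :: 'a) else 0))"
    by (simp add: sum_subtractf sum_distrib_left[symmetric] sum_quad_char)
  also have "\<dots> = (\<Sum>x\<in>UNIV. if x = (0::'a) then 0 else 2 * ?q)"
  proof (rule sum.cong)
    fix x :: 'a
    show "(\<Sum>y\<in>UNIV. (if x ^ 2 = y ^ 2 then ?q * quad_char (x * y) else 0)) = (if x = 0 then 0 else 2 * ?q)"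
    proof (cases "x = 0")
      case False
      have "x \<noteq> - x"
        using False two_neq_zero[OF odd_card] by (simp add: eq_neg_iff_add_eq_0 flip: mult_2)
      have "(\<Sum>y\<in>UNIV. (if x ^ 2 = y ^ 2 then ?q * quad_char (x * y) else 0)) =
          (\<Sum>y\<in>{x, - x}. ?q * quad_char (x * y))"
        by (rule sum.mono_neutral_cong_right) (auto simp: power2_eq_iff)
      also have "\<dots> = ?q * quad_char (x ^ 2) + ?q * quad_char (- 1 * x ^ 2)"
        using \<open>x \<noteq> - x\<close> by (simp add: power2_eq_square)
      also have "\<dots> = 2 * ?q"
        using False assms unfolding quad_char_mult quad_char_power2 by (simp add: quad_char_def)
      finally show ?thesis
        using False by simp
    qed simp
  qed simp
  also have "\<dots> = (\<Sum>x\<in>UNIV - {0::'a}. 2 * ?q)"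
    by (rule sum.mono_neutral_cong_right) auto
  also have "\<dots> = 2 * ?q * (?q - 1)"
    by (simp add: card_Diff_singleton of_nat_diff Suc_leI finite_UNIV_card_ge_0)
  finally show ?thesis .
qed

text \<open>Hasse's bound for these curves by averaging: the (q - 1)/2 multiples of \<open>a\<close>
  by nonzero squares all give the same square, and together they stay below the second moment 2 q (q
  - 1).\<close>

lemma jacobsthal_bound:
  assumes "square (- 1 :: 'a)" "a \<noteq> 0"
  shows "(jacobsthal a) ^ 2 \<le> 4 * int CARD('a)"
proof -
  let ?q = "int CARD('a)" and ?S = "{x::'a. x \<noteq> 0 \<and> square x}"
  have q: "?q \<ge> 2"
    using card_mono[of "UNIV :: 'a set" "{0, 1}"] by simp
  have "2 * int (card ?S) = ?q - 1"
    using card_nonzero_squares[OF odd_card] odd_card q by (auto elim!: oddE)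
  have "int (card ?S) * (jacobsthal a) ^ 2 = (\<Sum>s\<in>?S. (jacobsthal (a * s)) ^ 2)"
    by (subst sum.cong[OF refl, of _ _ "\<lambda>_. (jacobsthal a) ^ 2"])
      (auto simp: square_def jacobsthal_mult_power2)
  also have "\<dots> = (\<Sum>b\<in>(\<lambda>s. a * s) ` ?S. (jacobsthal b) ^ 2)"
    by (rule sum.reindex_cong[symmetric, of "\<lambda>s. a * s"]) (use assms in \<open>auto simp: inj_on_def\<close>)
  also have "\<dots> \<le> (\<Sum>b\<in>UNIV. (jacobsthal b) ^ 2)"
    by (rule sum_mono2) auto
  finally have "2 * int (card ?S) * (jacobsthal a) ^ 2 \<le> 4 * ?q * (?q - 1)"
    by (simp add: sum_jacobsthal_power2[OF assms(1)] algebra_simps)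
  then have "(?q - 1) * (jacobsthal a) ^ 2 \<le> (?q - 1) * (4 * ?q)"
    unfolding \<open>2 * int (card ?S) = ?q - 1\<close> by (simp add: algebra_simps)
  then show ?thesis
    using q by simp
qed

text \<open>Counting in u = t^2 - 2: wanted are u + 2 and u squares and u - 2 a nonsquare. A product
  of three factors 1 + chi or 1 - chi detects them; its sum is q + 1 minus a Jacobsthal sum. If
  nothing is found, only u = 2 contributes, namely 4, so the Jacobsthal sum is q - 3, too large for
  q > 9.\<close>

lemma ex_nonsquare_minus_four_square_two_minus:
  assumes mod8: "CARD('a) mod 8 = 1" and "CARD('a) > 9"
  shows "\<exists>t b::'a. \<not> square (t ^ 2 - 4) \<and> 2 - t ^ 2 = b ^ 2"
proof (rule ccontr)
  assume none: "\<not> ?thesis"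
  let ?q = "int CARD('a)" and ?\<chi> = "quad_char :: 'a \<Rightarrow> int"
  have m1: "square (- 1 :: 'a)"
    using square_minus_one_iff[OF odd_card] mod8 by presburger
  have two: "square (2 :: 'a)" "(2 :: 'a) \<noteq> 0"
    using square_two_if_mod_8_eq_1[OF odd_card mod8] two_neq_zero[OF odd_card] by auto
  have four: "square (4 :: 'a)"
    using square_power2[of "2 :: 'a"] by simp
  have "(2 :: 'a) * 2 \<noteq> 0"
    using two(2) by (metis mult_eq_0_iff)
  then have four0: "(4 :: 'a) \<noteq> 0"
    by simp
  have minus: "?\<chi> (- x) = ?\<chi> x" for x
    using quad_char_mult[of "- 1" x] m1 by (simp add: quad_char_def)
  \<comment> \<open>From here on \<open>t\<close> plays the role of t^2 - 2 in the
    statement.\<close>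
  have "(1 + ?\<chi> (t + 2)) * (1 + ?\<chi> (t + 0)) * (1 - ?\<chi> (t + - 2)) = 0" if "t \<noteq> 2" for t
  proof (rule ccontr)
    assume "\<not> ?thesis"
    then have \<chi>: "?\<chi> (t + 2) \<noteq> - 1" "?\<chi> t \<noteq> - 1" "?\<chi> (t - 2) \<noteq> 1"
      by auto
    from that have "?\<chi> (t - 2) \<noteq> 0"
      by simp
    with \<chi>(3) have ns: "\<not> square (t - 2)"
      by (auto simp: quad_char_def split: if_splits)
    have "square u" if "?\<chi> u \<noteq> - 1" for u
      using that square_power2[of "0::'a"] by (auto simp: quad_char_def split: if_splits)
    with \<chi> obtain x y where xy: "t + 2 = x ^ 2" "t = y ^ 2"
      unfolding square_def by blast
    obtain i :: 'a where i: "- 1 = i ^ 2"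
      using m1 by (auto simp: square_def)
    have "2 - x ^ 2 = (i * y) ^ 2"
      unfolding power_mult_distrib i[symmetric] xy(1)[symmetric] xy(2)[symmetric] by simp
    moreover have "x ^ 2 - 4 = t - 2"
      by (simp flip: xy(1))
    ultimately show False
      using none ns by metis
  qed
  then have "(\<Sum>t\<in>UNIV. (1 + ?\<chi> (t + 2)) * (1 + ?\<chi> (t + 0)) * (1 - ?\<chi> (t + - 2))) =
      (\<Sum>t\<in>{2}. (1 + ?\<chi> (t + 2)) * (1 + ?\<chi> (t + 0)) * (1 - ?\<chi> (t + - 2)))"
    by (intro sum.mono_neutral_right) auto
  also have "\<dots> = 4"
    using two four0 four by (simp add: quad_char_def)
  also have "(\<Sum>t\<in>UNIV. (1 + ?\<chi> (t + 2)) * (1 + ?\<chi> (t + 0)) * (1 - ?\<chi> (t + - 2))) =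
    (\<Sum>t\<in>UNIV. 1 + ?\<chi> (t + 2) + ?\<chi> (t + 0) - ?\<chi> (t + - 2) + ?\<chi> ((t + 2) * (t + 0))
      - ?\<chi> ((t + 2) * (t + - 2)) - ?\<chi> ((t + 0) * (t + - 2)) - ?\<chi> (t * (t ^ 2 - 4)))"
  proof (intro sum.cong refl)
    fix t :: 'a
    have "t * (t ^ 2 - 4) = (t + 2) * (t + 0) * (t + - 2)"
      by (simp add: power2_eq_square algebra_simps)
    then show "(1 + ?\<chi> (t + 2)) * (1 + ?\<chi> (t + 0)) * (1 - ?\<chi> (t + - 2)) =
      1 + ?\<chi> (t + 2) + ?\<chi> (t + 0) - ?\<chi> (t + - 2) + ?\<chi> ((t + 2) * (t + 0))
      - ?\<chi> ((t + 2) * (t + - 2)) - ?\<chi> ((t + 0) * (t + - 2)) - ?\<chi> (t * (t ^ 2 - 4))"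
      by (simp only: quad_char_mult) (simp add: algebra_simps)
  qed
  also have "\<dots> = ?q + 1 - jacobsthal 4"
  proof -
    have "(2::'a) \<noteq> - 2"
      using four0 by (simp add: eq_neg_iff_add_eq_0)
    then show ?thesis
      using two unfolding sum.distrib sum_subtractf sum_quad_char_shift sum_quad_char_quadratic
      by (simp add: jacobsthal_def)
  qed
  finally have "jacobsthal 4 = ?q - 3"
    by simp
  with jacobsthal_bound[OF m1 four0] have "(?q - 3) ^ 2 \<le> 4 * ?q"
    by simp
  then have "(?q - 1) * (?q - 9) \<le> 0"
    by (simp add: power2_eq_square algebra_simps)
  then show False
    using assms(2) by (simp add: mult_le_0_iff)
qed

end

subsection \<open>Two by two matrices of determinant one\<close>

definition mat2 :: "'a \<Rightarrow> 'a \<Rightarrow> 'a \<Rightarrow> 'a \<Rightarrow> 'a::field ^ 2 ^ 2" where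
  "mat2 a b c d = vector [vector [a, b], vector [c, d]]"

lemma mat2_nth [simp]:
  "mat2 a b c d $ 1 $ 1 = a" "mat2 a b c d $ 1 $ 2 = b" "mat2 a b c d $ 2 $ 1 = c" "mat2 a b c d $ 2 $ 2 = d"
  by (simp_all add: mat2_def vector_2)

lemma mat2_eta: "A = mat2 (A $ 1 $ 1) (A $ 1 $ 2) (A $ 2 $ 1) (A $ 2 $ 2)"
  by (simp add: vec_eq_iff forall_2)

lemma mat2_cases [case_names mat2]:
  obtains a b c d where "A = mat2 a b c d"
  using mat2_eta by blast

lemma mat2_eq_iff [simp]: "mat2 a b c d = mat2 a' b' c' d' \<longleftrightarrow> a = a' \<and> b = b' \<and> c = c' \<and> d = d'"
  by (auto simp: vec_eq_iff forall_2)

lemma mat2_mult [simp]: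
  "mat2 a b c d ** mat2 a' b' c' d' =
    mat2 (a * a' + b * c') (a * b' + b * d') (c * a' + d * c') (c * b' + d * d')"
  by (simp add: vec_eq_iff forall_2 matrix_matrix_mult_def sum_2)

lemma mat2_uminus [simp]: "- mat2 a b c d = mat2 (- a) (- b) (- c) (- d)"
  by (simp add: vec_eq_iff forall_2)

lemma mat_eq_mat2: "mat k = mat2 k 0 0 k"
  by (simp add: vec_eq_iff forall_2 mat_def)

lemma det_mat2 [simp]: "det (mat2 a b c d) = a * d - b * c"
  by (simp add: det_2)

lemma trace_mat2 [simp]: "trace (mat2 a b c d) = a + d"
  by (simp add: trace_def sum_2)

lemma trace_uminus_mat2: "trace (- A :: 'a::field ^ 2 ^ 2) = - trace A"
  by (simp add: trace_def sum_2)

text \<open>The adjugate. It inverts matrices of determinant one, but its rules for products and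
  traces hold for all matrices.\<close>

definition adj2 :: "'a::field ^ 2 ^ 2 \<Rightarrow> 'a ^ 2 ^ 2" where
  "adj2 A = mat2 (A $ 2 $ 2) (- (A $ 1 $ 2)) (- (A $ 2 $ 1)) (A $ 1 $ 1)"

lemma adj2_mat2 [simp]: "adj2 (mat2 a b c d) = mat2 d (- b) (- c) a"
  by (simp add: adj2_def)

lemma adj2_adj2 [simp]: "adj2 (adj2 A) = A"
  by (cases A rule: mat2_cases) simp

lemma adj2_mat1 [simp]: "adj2 (mat 1) = mat 1"
  by (simp add: mat_eq_mat2)

lemma adj2_uminus: "adj2 (- A) = - adj2 A"
  by (cases A rule: mat2_cases) simp

lemma adj2_mult: "adj2 (A ** B) = adj2 B ** adj2 A"
  by (cases A rule: mat2_cases; cases B rule: mat2_cases) (simp add: algebra_simps)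

lemma det_adj2 [simp]: "det (adj2 A) = det A"
  by (cases A rule: mat2_cases) (simp add: algebra_simps)

lemma trace_adj2 [simp]: "trace (adj2 A) = trace A"
  by (cases A rule: mat2_cases) (simp add: algebra_simps)

lemma adj2_left: "det A = 1 \<Longrightarrow> adj2 A ** A = mat 1"
  by (cases A rule: mat2_cases) (simp add: mat_eq_mat2 algebra_simps)

lemma adj2_right: "det A = 1 \<Longrightarrow> A ** adj2 A = mat 1"
  by (cases A rule: mat2_cases) (simp add: mat_eq_mat2 algebra_simps)

lemma adj2_left_assoc: "det A = 1 \<Longrightarrow> adj2 A ** (A ** M) = M"
  by (simp add: adj2_left matrix_mul_assoc)

lemma adj2_right_assoc: "det A = 1 \<Longrightarrow> A ** (adj2 A ** M) = M"
  by (simp add: adj2_right matrix_mul_assoc)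

lemma trace_mult_commute2: "trace (A ** B) = trace (B ** (A :: 'a::field ^ 2 ^ 2) :: 'a ^ 2 ^ 2)"
  by (cases A rule: mat2_cases; cases B rule: mat2_cases) (simp add: algebra_simps)

lemma mult_uminus_left2: "(- A) ** B = - (A ** (B :: 'a::field ^ 2 ^ 2) :: 'a ^ 2 ^ 2)"
  by (cases A rule: mat2_cases; cases B rule: mat2_cases) (simp add: algebra_simps)

lemma mult_uminus_right2: "A ** (- B) = - (A ** (B :: 'a::field ^ 2 ^ 2) :: 'a ^ 2 ^ 2)"
  by (cases A rule: mat2_cases; cases B rule: mat2_cases) (simp add: algebra_simps)

definition commutes :: "'a::field ^ 2 ^ 2 \<Rightarrow> 'a ^ 2 ^ 2 \<Rightarrow> bool" where
  "commutes A B \<longleftrightarrow> A ** B = B ** A"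

text \<open>Only traceless parts matter: the three equations are the minors saying that (b, c, a -
  d) and (q, r, p - u) are proportional.\<close>

lemma commutes_mat2_iff:
  "commutes (mat2 a b c d) (mat2 p q r u) \<longleftrightarrow>
    b * r = c * q \<and> (a - d) * q = b * (p - u) \<and> (a - d) * r = c * (p - u)"
proof -
  have "a * p + b * r = p * a + q * c \<longleftrightarrow> b * r = c * q"
    "c * q + d * u = r * b + u * d \<longleftrightarrow> b * r = c * q"
    "a * q + b * u = p * b + q * d \<longleftrightarrow> (a - d) * q = b * (p - u)"
    "c * p + d * r = r * a + u * c \<longleftrightarrow> (a - d) * r = c * (p - u)"
    by (auto simp: algebra_simps)
  then show ?thesis
    by (auto simp: commutes_def)
qed

lemma commutes_sym: "commutes A B \<Longrightarrow> commutes B A"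
  by (simp add: commutes_def)

lemma commutes_adj2_iff: "commutes (adj2 A) B \<longleftrightarrow> commutes A B"
  by (cases A rule: mat2_cases; cases B rule: mat2_cases) (auto simp: commutes_mat2_iff algebra_simps)

lemma mult_right_cancel2:
  assumes "det C = 1"
  shows "A ** C = B ** C \<longleftrightarrow> A = (B :: 'a::field ^ 2 ^ 2)"
proof
  assume "A ** C = B ** C"
  then have "A ** (C ** adj2 C) = B ** (C ** adj2 C)"
    by (simp only: matrix_mul_assoc)
  then show "A = B"
    by (simp add: adj2_right assms)
qed simp

lemma mult_left_cancel2:
  assumes "det C = 1"
  shows "C ** A = C ** B \<longleftrightarrow> A = (B :: 'a::field ^ 2 ^ 2)"
proof
  assume "C ** A = C ** B"
  then have "adj2 C ** (C ** A) = adj2 C ** (C ** B)"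
    by simp
  then show "A = B"
    by (simp add: adj2_left_assoc assms)
qed simp

lemma commutes_self_mult_iff:
  assumes "det B = 1"
  shows "commutes (A ** B) B \<longleftrightarrow> commutes A B"
  using mult_right_cancel2[OF assms, of "A ** B" "B ** A"]
  by (simp add: commutes_def matrix_mul_assoc)

lemma commutes_conj_self_iff:
  assumes "det B = 1"
  shows "commutes (adj2 B ** A ** B) B \<longleftrightarrow> commutes A B"
proof -
  have "commutes (adj2 B ** A ** B) B \<longleftrightarrow> commutes (adj2 B ** A) B"
    by (rule commutes_self_mult_iff[OF assms])
  also have "\<dots> \<longleftrightarrow> commutes (adj2 A ** B) B"
    by (subst commutes_adj2_iff[symmetric]) (simp add: adj2_mult)
  also have "\<dots> \<longleftrightarrow> commutes A B"
    using assms by (simp add: commutes_self_mult_iff commutes_adj2_iff)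
  finally show ?thesis .
qed

text \<open>The centralizer of a nonscalar matrix A consists of the combinations l + k A;
  \<open>k\<close> is the quotient of two corresponding coordinates of the traceless parts.\<close>

lemma commutes_nonscalar:
  assumes "commutes (mat2 a b c d) (mat2 p q r u)" "\<not> (b = 0 \<and> c = 0 \<and> a = d)"
  obtains l k where "p = l + k * a" "q = k * b" "r = k * c" "u = l + k * d"
proof -
  have eq: "b * r = c * q" "(a - d) * q = b * (p - u)" "(a - d) * r = c * (p - u)"
    using assms(1) by (simp_all add: commutes_mat2_iff)
  consider "c \<noteq> 0" | "b \<noteq> 0" "c = 0" | "b = 0" "c = 0" "a - d \<noteq> 0"
    using assms(2) by auto
  then show ?thesis
  proof cases
    case 1
    then show ?thesis
      using eq by (intro that[of "p - r / c * a" "r / c"]) (auto simp: field_simps)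
  next
    case 2
    then show ?thesis
      using eq by (intro that[of "p - q / b * a" "q / b"]) (auto simp: field_simps)
  next
    case 3
    define k where "k = (p - u) / (a - d)"
    have "k * (a - d) = p - u"
      using 3 by (simp add: k_def)
    then have "u = (p - k * a) + k * d"
      by Groebner_Basis.algebra
    then show ?thesis
      using 3 eq by (intro that[of "p - k * a" k]) auto
  qed
qed

text \<open>In the exceptional case \<open>trace B = 2\<close> or \<open>trace B = - 2\<close> the traceless parts of \<open>B\<close> and
  \<open>C\<close> are nilpotent of rank one, and the vanishing trace of their product makes them
  proportional.\<close>

lemma commutes_if_commutes_conj:
  assumes "(2::'a::field) \<noteq> 0" "det B = (1::'a)" "det C = 1" "trace C = trace B" "trace B \<noteq> 0"
    and "commutes (adj2 C ** B ** C) B"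
  shows "commutes C B"
proof (cases B rule: mat2_cases)
  case B: (mat2 a b c d)
  show ?thesis
  proof (cases C rule: mat2_cases)
    case C: (mat2 p q r u)
    show ?thesis
    proof (cases "b = 0 \<and> c = 0 \<and> a = d")
      case True
      then show ?thesis
        by (simp add: B C commutes_mat2_iff)
    next
      case False
      define D where "D = adj2 C ** B ** C"
      obtain x y z w where D: "D = mat2 x y z w"
        by (cases D rule: mat2_cases)
      have "commutes B D"
        using assms(6) by (simp add: D_def commutes_sym)
      then obtain l k where lk: "x = l + k * a" "y = k * b" "z = k * c" "w = l + k * d"
        using commutes_nonscalar[OF _ False] unfolding B D by metis
      have detB: "a * d - b * c = 1" and detC: "p * u - q * r = 1"
        using assms by (simp_all add: B C)
      define t where "t = a + d"
      have t: "p + u = t" "t \<noteq> 0"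
        using assms by (simp_all add: B C t_def)
      have "C ** D = B ** C"
        by (simp add: D_def matrix_mul_assoc adj2_right assms)
      then have CD: "p * x + q * z = a * p + b * r" "p * y + q * w = a * q + b * u"
        "r * x + u * z = c * p + d * r" "r * y + u * w = c * q + d * u"
        by (simp_all add: B C D)
      have "det D = 1"
        by (simp add: D_def det_mul assms)
      then have detD: "(l + k * a) * (l + k * d) - k * b * (k * c) = 1"
        by (simp add: D lk)
      have "trace D = trace B"
        by (simp add: D_def trace_mult_commute2[of _ C] matrix_mul_assoc adj2_right assms)
      then have trD: "2 * l = t * (1 - k)"
        by (simp add: D B lk t_def algebra_simps)
      \<comment> \<open>The trace of B C. Taking traces in C D = B C with D = l + k B gives s = l t
        + k s.\<close>
      define s where "s = a * p + b * r + c * q + d * u"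
      have "s = (p * x + q * z) + (r * y + u * w)"
        using CD(1,4) by (simp add: s_def add_ac)
      also have "\<dots> = l * (p + u) + k * s"
        by (simp add: lk s_def algebra_simps)
      finally have st: "s - k * s = l * t"
        unfolding t(1) by (simp only: diff_eq_eq)
      have "(1 - k) * (2 * s - t ^ 2) = 2 * (s - k * s) - t * (t * (1 - k))"
        by (simp add: algebra_simps power2_eq_square)
      then have s: "(1 - k) * (2 * s - t ^ 2) = 0"
        unfolding st trD[symmetric] by simp
      have "(l + k * a) * (l + k * d) - k * b * (k * c) = l ^ 2 + l * k * t + k ^ 2 * (a * d - b * c)"
        by (simp add: t_def algebra_simps power2_eq_square)
      then have "l ^ 2 + l * k * t + k ^ 2 = 1"
        unfolding detB detD by simp
      moreover have "4 * (l ^ 2 + l * k * t + k ^ 2) = (2 * l) ^ 2 + 2 * (2 * l) * k * t + 4 * k ^ 2"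
        by (simp add: algebra_simps power2_eq_square)
      ultimately have "(t * (1 - k)) ^ 2 + 2 * (t * (1 - k)) * k * t + 4 * k ^ 2 = 4"
        unfolding trD by simp
      then have k: "(1 - k) * ((1 + k) * (t ^ 2 - 4)) = 0"
        by (simp add: algebra_simps power2_eq_square)
      show ?thesis
      proof (cases "k = 1")
        case True
        then have "l = 0"
          using trD assms(1) by simp
        then show ?thesis
          using \<open>C ** D = B ** C\<close> True unfolding commutes_def B D lk by simp
      next
        case False
        then have s2: "2 * s = t ^ 2"
          using s by simp
        have "t ^ 2 = 4"
        proof (cases "1 + k = 0")
          case True
          then have "k = - 1"
            by (simp add: eq_neg_iff_add_eq_0 add.commute)
          then have "2 * (l - t) = 0"
            using trD by (simp add: algebra_simps)
          then have "l = t"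
            using assms(1) by (auto simp only: mult_eq_0_iff right_minus_eq)
          \<comment> \<open>Now D = t - B is the inverse of B, and \<open>e\<close> lists the
            entries of B C + C B - t C = 0. Multiplying by B and taking the trace, Cayley-Hamilton
            leaves t s - 2 t.\<close>
          have e: "a * p + b * r - t * p + p * a + q * c = 0" "a * q + b * u - t * q + p * b + q * d = 0"
            "c * p + d * r - t * r + r * a + u * c = 0" "c * q + d * u - t * u + r * b + u * d = 0"
            using CD unfolding lk \<open>k = - 1\<close> \<open>l = t\<close> by (simp_all add: algebra_simps)
          have "a * (a * p + b * r - t * p + p * a + q * c) + b * (c * p + d * r - t * r + r * a + u * c)
              + c * (a * q + b * u - t * q + p * b + q * d) + d * (c * q + d * u - t * u + r * b + u * d)
              = t * s - 2 * (a * d - b * c) * (p + u)"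
            by (simp add: t_def s_def algebra_simps)
          then have "t * (s - 2) = 0"
            unfolding e detB t(1) by (simp add: algebra_simps)
          then have "s = 2"
            using t(2) by simp
          then show ?thesis
            using s2 by simp
        next
          case False
          then show ?thesis
            using k \<open>k \<noteq> 1\<close> by simp
        qed
        then have "2 * (s - 2) = 0"
          using s2 by (simp add: algebra_simps)
        then have "s = 2"
          using assms(1) by (auto simp only: mult_eq_0_iff right_minus_eq)
        define x' y' where "x' = a - d" and "y' = p - u"
        have ad: "a * d = 1 + b * c" and pu: "p * u = 1 + q * r"
          using detB detC by (simp_all add: algebra_simps)
        have "x' ^ 2 = t ^ 2 - 4 * (a * d)" "y' ^ 2 = (p + u) ^ 2 - 4 * (p * u)"
          by (simp_all add: x'_def y'_def t_def power2_eq_square algebra_simps)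
        then have x2: "x' ^ 2 = - 4 * (b * c)" and y2: "y' ^ 2 = - 4 * (q * r)"
          unfolding ad pu t(1) \<open>t ^ 2 = 4\<close> by (simp_all add: algebra_simps)
        have "2 * s = t * (p + u) + x' * y' + 2 * (b * r + c * q)"
          by (simp add: s_def x'_def y'_def t_def algebra_simps)
        then have xy: "x' * y' = - 2 * (b * r + c * q)"
          unfolding t(1) power2_eq_square[symmetric] \<open>s = 2\<close> \<open>t ^ 2 = 4\<close>
          by (simp add: algebra_simps eq_neg_iff_add_eq_0)
        \<comment> \<open>Comparing (x' y')^2 with x'^2 y'^2 shows that the square of the first
          minor vanishes; the other two minors are squared likewise.\<close>
        have "4 * (b * r - c * q) ^ 2 = (- 2 * (b * r + c * q)) ^ 2 - (- 4 * (b * c)) * (- 4 * (q * r))"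
          by (simp add: power2_eq_square algebra_simps)
        then have "4 * (b * r - c * q) ^ 2 = 0"
          unfolding xy[symmetric] x2[symmetric] y2[symmetric] by (simp add: power_mult_distrib)
        moreover have "(x' * q - b * y') ^ 2 = x' ^ 2 * q ^ 2 - 2 * b * q * (x' * y') + b ^ 2 * y' ^ 2"
          "(x' * r - c * y') ^ 2 = x' ^ 2 * r ^ 2 - 2 * c * r * (x' * y') + c ^ 2 * y' ^ 2"
          by (simp_all add: power2_eq_square algebra_simps)
        then have "(x' * q - b * y') ^ 2 = 0" "(x' * r - c * y') ^ 2 = 0"
          unfolding xy x2 y2 by (simp_all add: power2_eq_square algebra_simps)
        moreover have "(2::'a) * 2 \<noteq> 0"
          using assms(1) by (metis mult_eq_0_iff)
        then have "(4::'a) \<noteq> 0"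
          by simp
        ultimately have "b * r = c * q"
          by simp
        moreover from \<open>(x' * q - b * y') ^ 2 = 0\<close> have "x' * q = b * y'"
          by simp
        moreover from \<open>(x' * r - c * y') ^ 2 = 0\<close> have "x' * r = c * y'"
          by simp
        ultimately have "commutes B C"
          by (simp add: B C commutes_mat2_iff x'_def y'_def)
        then show ?thesis
          by (rule commutes_sym)
      qed
    qed
  qed
qed

subsection \<open>Iterated commutators\<close>

definition pm_one :: "'a::field ^ 2 ^ 2 \<Rightarrow> bool" where
  "pm_one A \<longleftrightarrow> A = mat 1 \<or> A = - mat 1"

primrec sl2_engel :: "'a::field ^ 2 ^ 2 \<Rightarrow> nat \<Rightarrow> 'a ^ 2 ^ 2 \<Rightarrow> 'a ^ 2 ^ 2" where
  "sl2_engel A 0 B = A"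
| "sl2_engel A (Suc i) B = adj2 (sl2_engel A i B) ** adj2 B ** sl2_engel A i B ** B"

lemma det_sl2_engel [simp]: "det A = 1 \<Longrightarrow> det B = 1 \<Longrightarrow> det (sl2_engel A n B) = 1"
  by (induction n) (simp_all add: det_mul)

lemma pm_one_adj2 [simp]: "pm_one (adj2 A) \<longleftrightarrow> pm_one A"
  by (cases A rule: mat2_cases) (auto simp: pm_one_def mat_eq_mat2)

lemma pm_one_uminus [simp]: "pm_one (- A) \<longleftrightarrow> pm_one A"
  unfolding pm_one_def by (metis minus_minus)

lemma pm_one_step: "pm_one A \<Longrightarrow> det B = 1 \<Longrightarrow> adj2 A ** adj2 B ** A ** B = mat 1"
  by (auto simp: pm_one_def adj2_left adj2_uminus mult_uminus_left2 mult_uminus_right2)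

lemma pm_one_sl2_engel_mono:
  assumes "pm_one (sl2_engel A m B)" "m \<le> n" "det B = 1"
  shows "pm_one (sl2_engel A n B)"
  using assms(2,1)
proof (induction n rule: dec_induct)
  case (step n)
  then show ?case
    using pm_one_step[OF _ assms(3)] by (simp add: pm_one_def)
qed

lemma commutator_eq_iff:
  assumes "det A = 1" "det B = 1"
  shows "adj2 A ** adj2 B ** A ** B = M \<longleftrightarrow> A ** B = B ** A ** (M :: 'a::field ^ 2 ^ 2)"
proof -
  have BA: "det (B ** A) = 1"
    using assms by (simp add: det_mul)
  have "adj2 A ** adj2 B ** A ** B = adj2 (B ** A) ** (A ** B)"
    by (simp add: adj2_mult matrix_mul_assoc)
  then show ?thesis
    using mult_left_cancel2[OF BA, of "adj2 (B ** A) ** (A ** B)" M] by (simp only: adj2_right_assoc[OF BA])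
qed

lemma commutator_eq_one_iff:
  assumes "det A = 1" "det B = 1"
  shows "adj2 A ** adj2 B ** A ** B = mat 1 \<longleftrightarrow> commutes A B"
  using commutator_eq_iff[OF assms] by (simp add: commutes_def)

lemma commutator_eq_minus_one_iff:
  assumes "det A = 1" "det B = 1"
  shows "adj2 A ** adj2 B ** A ** B = - mat 1 \<longleftrightarrow> A ** B = - (B ** A)"
  using commutator_eq_iff[OF assms, of "- mat 1"] by (simp add: mult_uminus_right2)

lemma trace_conj2:
  assumes "det A = 1"
  shows "trace (adj2 A ** B ** A) = trace (B :: 'a::field ^ 2 ^ 2)"
proof -
  have "trace (adj2 A ** B ** A) = trace (A ** (adj2 A ** B))"
    by (rule trace_mult_commute2)
  then show ?thesis
    by (simp add: adj2_right_assoc assms)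
qed

text \<open>B is conjugate to -B. This rules out the value -1 of a commutator in SL2 unless the
  trace vanishes.\<close>

lemma anticommute_imp_trace_zero:
  assumes "(2::'a::field) \<noteq> 0" "A ** B = - (B ** (A :: 'a ^ 2 ^ 2))" "det A = 1"
  shows "trace B = 0"
proof -
  have "adj2 A ** (A ** B) = - (adj2 A ** B ** A)"
    unfolding assms(2) by (simp add: mult_uminus_right2 matrix_mul_assoc)
  then have "B = - (adj2 A ** B ** A)"
    using assms(3) by (simp add: adj2_left_assoc)
  then have "trace B = - trace (adj2 A ** B ** A)"
    by (metis trace_uminus_mat2)
  also have "trace (adj2 A ** B ** A) = trace B"
    by (rule trace_conj2[OF assms(3)])
  finally show ?thesis
    using assms(1) by (simp add: eq_neg_iff_add_eq_0 flip: mult_2)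
qed

lemma pm_one_sl2_engel_one_iff:
  assumes "det A = 1" "det B = 1"
  shows "pm_one (sl2_engel A 1 B) \<longleftrightarrow> commutes A B \<or> A ** B = - (B ** A)"
  using assms commutator_eq_one_iff[OF assms] commutator_eq_minus_one_iff[OF assms]
  by (auto simp: pm_one_def)

text \<open>Write [Z,B] = C B with C the conjugate of the inverse of B by Z. Conjugation by C B and
  by C have the same effect on commuting with B, and as C has the trace of B,
  \<open>commutes_if_commutes_conj\<close> makes C itself commute with B. So \<open>?Q\<close>
  descends from [Z,B] to Z, and by induction to A.\<close>

lemma pm_one_sl2_engel_iff_commutes_conj:
  assumes two: "(2::'a::field) \<noteq> 0" and det: "det A = (1::'a)" "det B = 1"
    and tr: "trace B \<noteq> 0" and "n \<ge> 2"
  shows "pm_one (sl2_engel A n B) \<longleftrightarrow> commutes (adj2 A ** B ** A) B"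
proof -
  let ?Q = "\<lambda>A. commutes (adj2 A ** B ** A) B"
  have Q: "?Q (adj2 Z ** adj2 B ** Z ** B) \<Longrightarrow> ?Q Z" and comm: "commutes (adj2 Z ** adj2 B ** Z ** B) B \<longleftrightarrow> ?Q Z"
    if "det Z = 1" for Z
  proof -
    define C where "C = adj2 Z ** adj2 B ** Z"
    have adjC: "adj2 C = adj2 Z ** B ** Z"
      by (simp add: C_def adj2_mult matrix_mul_assoc)
    show "commutes (adj2 Z ** adj2 B ** Z ** B) B \<longleftrightarrow> ?Q Z"
      using commutes_self_mult_iff[OF det(2), of C] commutes_adj2_iff[of C B] adjC
      by (simp add: C_def[symmetric])
    assume "?Q (adj2 Z ** adj2 B ** Z ** B)"
    then have "commutes (adj2 B ** (adj2 C ** B ** C) ** B) B"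
      by (simp add: C_def[symmetric] adj2_mult matrix_mul_assoc)
    then have "commutes (adj2 C ** B ** C) B"
      using commutes_conj_self_iff[OF det(2)] by blast
    moreover have "trace C = trace B"
      using trace_conj2[OF that, of "adj2 B"] by (simp add: C_def)
    moreover have "det C = 1"
      by (simp add: C_def det_mul det that)
    ultimately have "commutes C B"
      using commutes_if_commutes_conj[OF two det(2)] tr by blast
    then show "?Q Z"
      using commutes_adj2_iff[of C B] adjC by simp
  qed
  have down: "?Q (sl2_engel A k B) \<Longrightarrow> ?Q A" for k
    by (induction k) (use Q det in auto)
  have "pm_one (sl2_engel A n B) \<Longrightarrow> ?Q A"
  proof -
    assume *: "pm_one (sl2_engel A n B)"
    \<comment> \<open>Two commutators are used up at the top: the last is central, so the one before
      commutes with B, which is \<open>?Q\<close> for its predecessor.\<close>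
    obtain k where k: "n = Suc (Suc k)"
      using \<open>n \<ge> 2\<close> by (metis Suc_le_D numeral_2_eq_2 Suc_le_mono)
    define Y where "Y = sl2_engel A (Suc k) B"
    have Y: "det Y = 1"
      using det unfolding Y_def by (rule det_sl2_engel)
    have "pm_one (sl2_engel Y 1 B)"
      using * unfolding k Y_def by simp
    then have "commutes (sl2_engel A (Suc k) B) B"
      using pm_one_sl2_engel_one_iff[OF Y det(2)] anticommute_imp_trace_zero[OF two _ Y] tr
      unfolding Y_def by blast
    then have "?Q (sl2_engel A k B)"
      using comm[of "sl2_engel A k B"] det by simp
    then show "?Q A"
      by (rule down)
  qed
  moreover have "pm_one (sl2_engel A n B)" if "?Q A"
  proof (rule pm_one_sl2_engel_mono[OF _ \<open>n \<ge> 2\<close> det(2)])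
    define Y where "Y = sl2_engel A 1 B"
    have Y: "det Y = 1"
      using det unfolding Y_def by (rule det_sl2_engel)
    have "commutes Y B"
      using comm[of A] that det by (simp add: Y_def)
    then have "sl2_engel Y 1 B = mat 1"
      using commutator_eq_one_iff[OF Y det(2)] by simp
    then have "sl2_engel A 2 B = mat 1"
      by (simp add: Y_def numeral_2_eq_2)
    then show "pm_one (sl2_engel A 2 B)"
      by (simp add: pm_one_def)
  qed
  ultimately show ?thesis
    by blast
qed

text \<open>By Cayley-Hamilton A^2 = t A - 1, which is scalar only if A is scalar or t = 0.\<close>

lemma pm_one_square_iff:
  assumes "(2::'a::field) \<noteq> 0" "det A = (1::'a)"
  shows "pm_one (A ** A) \<longleftrightarrow> pm_one A \<or> trace A = 0"
proof (cases A rule: mat2_cases)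
  case (mat2 a b c d)
  have "pm_one A" if "b * (a + d) = 0" "c * (a + d) = 0" "a + d \<noteq> 0" "a * a + b * c = c * b + d * d"
  proof -
    from that have "b = 0" "c = 0"
      by simp_all
    moreover have "(a - d) * (a + d) = 0"
      using that(4) by (simp add: algebra_simps)
    then have "a = d"
      using that(3) by simp
    ultimately show ?thesis
      using assms(2) square_eq_1_iff[of d] by (auto simp: mat2 pm_one_def mat_eq_mat2)
  qed
  moreover have "b * (a + d) = 0" "c * (a + d) = 0" if "pm_one (A ** A)"
    using that by (auto simp: mat2 pm_one_def mat_eq_mat2 algebra_simps)
  moreover have "a * a + b * c = c * b + d * d" if "pm_one (A ** A)"
    using that unfolding mat2 pm_one_def mat_eq_mat2 mat2_mult mat2_uminus mat2_eq_iff by metis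
  moreover have "pm_one (A ** A)" if "a + d = 0"
  proof -
    have "d = - a"
      using that by (simp add: eq_neg_iff_add_eq_0 add.commute)
    then have "- (a * a + b * c) = 1"
      using assms(2) by (simp add: mat2)
    then have "a * a + b * c = - 1"
      by (metis minus_minus)
    then show ?thesis
      using \<open>d = - a\<close> by (simp add: mat2 pm_one_def mat_eq_mat2 algebra_simps)
  qed
  moreover have "pm_one (A ** A)" if "pm_one A"
    using that by (auto simp: pm_one_def mult_uminus_left2 mult_uminus_right2)
  ultimately show ?thesis
    by (auto simp: mat2)
qed

lemma trace_square: "det A = 1 \<Longrightarrow> trace (A ** A) = (trace A) ^ 2 - (2::'a::field)"
  for A :: "'a::field ^ 2 ^ 2"
  by (cases A rule: mat2_cases) (simp add: power2_eq_square algebra_simps)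

lemma trace_adj2_mult: "trace (adj2 A ** B) = trace A * trace B - trace (A ** (B :: 'a::field ^ 2 ^ 2))"
  by (cases A rule: mat2_cases; cases B rule: mat2_cases) (simp add: algebra_simps)

lemma pm_one_sl2_engel_involution_iff:
  assumes two: "(2::'a::field) \<noteq> 0" and det: "det A = (1::'a)" "det B = 1" and tr: "trace B = 0"
  shows "pm_one (sl2_engel A (Suc k) B) \<longleftrightarrow>
    commutes A B \<or> A ** B = - (B ** A) \<or>
    (\<exists>i<k. (trace_sq ^^ i) ((trace A) ^ 2 + (trace (A ** B)) ^ 2 - 2) = 0)"
proof -
  have adjB: "adj2 B = - B"
    using tr by (cases B rule: mat2_cases) (auto simp: eq_neg_iff_add_eq_0 add.commute)
  let ?R = "\<lambda>k. sl2_engel A (Suc k) B"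
  have BB: "B ** B = - mat 1"
    using adj2_right[OF det(2)] unfolding adjB by (simp add: mult_uminus_right2 equation_minus_iff)
  \<comment> \<open>B squares to -1, so conjugation by B inverts each commutator with B; a further
    commutator is then the square of the inverse.\<close>
  have inv: "adj2 B ** ?R k ** B = adj2 (?R k)" for k
  proof -
    define Z where "Z = sl2_engel A k B"
    have Z: "det Z = 1"
      using det by (simp add: Z_def)
    have BBM: "B ** (B ** M) = - M" for M :: "'a ^ 2 ^ 2"
      by (simp add: matrix_mul_assoc BB mult_uminus_left2)
    show ?thesis
      by (simp add: Z_def[symmetric] adj2_mult adj2_uminus adjB mult_uminus_left2 mult_uminus_right2 BBM BB flip: matrix_mul_assoc)
  qed
  have step: "?R (Suc k) = adj2 (?R k) ** adj2 (?R k)" for k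
    using inv[of k] by (simp add: matrix_mul_assoc[symmetric])
  have tr0: "trace (?R 0) = (trace A) ^ 2 + (trace (A ** B)) ^ 2 - 2"
  proof -
    have "?R 0 = - (adj2 A ** (B ** A ** B))"
      by (simp add: adjB mult_uminus_left2 mult_uminus_right2 matrix_mul_assoc)
    then have "trace (?R 0) = - trace (adj2 A ** (B ** A ** B))"
      by (simp only: trace_uminus_mat2)
    also have "\<dots> = trace ((A ** B) ** (A ** B)) - trace A * trace (B ** (A ** B))"
      unfolding trace_adj2_mult by (simp add: matrix_mul_assoc)
    also have "trace (B ** (A ** B)) = trace (A ** (B ** B))"
      by (simp add: trace_mult_commute2[of B "A ** B"] flip: matrix_mul_assoc)
    also have "\<dots> = - trace A"
      by (simp add: BB mult_uminus_right2 trace_uminus_mat2)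
    finally show ?thesis
      using det by (simp add: trace_square det_mul power2_eq_square)
  qed
  have trk: "trace (?R k) = (trace_sq ^^ k) (trace (?R 0))" for k
  proof (induction k)
    case (Suc k)
    have "trace (?R (Suc k)) = trace_sq (trace (?R k))"
      unfolding step using trace_square[of "adj2 (?R k)"] det by (simp add: trace_sq_def del: sl2_engel.simps)
    then show ?case
      using Suc by simp
  qed simp
  \<comment> \<open>\<open>?R 0\<close> is already the first commutator, so \<open>Suc k\<close>
    commutators amount to only \<open>k\<close> squarings, and the tested traces are those with
    index below \<open>k\<close>.\<close>
  have "pm_one (?R k) \<longleftrightarrow> pm_one (?R 0) \<or> (\<exists>i<k. (trace_sq ^^ i) (trace (?R 0)) = 0)"
  proof (induction k)
    case (Suc k)
    have "pm_one (?R (Suc k)) \<longleftrightarrow> pm_one (?R k) \<or> trace (?R k) = 0"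
      unfolding step using pm_one_square_iff[OF two, of "adj2 (?R k)"] det by (simp del: sl2_engel.simps)
    then show ?case
      using Suc.IH trk[of k] by (auto simp: less_Suc_eq simp del: sl2_engel.simps)
  qed simp
  then show ?thesis
    unfolding tr0 using pm_one_sl2_engel_one_iff[OF det] by (auto simp del: sl2_engel.simps)
qed

subsection \<open>Conjugation and reachability\<close>

definition noncentral :: "'a::field ^ 2 ^ 2 \<Rightarrow> bool" where
  "noncentral A \<longleftrightarrow> det A = 1 \<and> \<not> pm_one A"

text \<open>Arcs are lifted to representatives in SL2, so a vertex of the quotient occurs as both A
  and -A.\<close>

definition sl2_arc :: "nat \<Rightarrow> 'a::field ^ 2 ^ 2 \<Rightarrow> 'a ^ 2 ^ 2 \<Rightarrow> bool" where
  "sl2_arc n A B \<longleftrightarrow> noncentral A \<and> noncentral B \<and> pm_one (sl2_engel A n B)"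

abbreviation sl2_reach :: "nat \<Rightarrow> 'a::field ^ 2 ^ 2 \<Rightarrow> 'a ^ 2 ^ 2 \<Rightarrow> bool" where
  "sl2_reach n \<equiv> (sl2_arc n)\<^sup>*\<^sup>*"

definition sl2_conj :: "'a::field ^ 2 ^ 2 \<Rightarrow> 'a ^ 2 ^ 2 \<Rightarrow> 'a ^ 2 ^ 2" where
  "sl2_conj P A = adj2 P ** A ** P"

lemma sl2_conj_mult: "det P = 1 \<Longrightarrow> sl2_conj P A ** sl2_conj P B = sl2_conj P (A ** B)"
  by (simp add: sl2_conj_def adj2_right_assoc flip: matrix_mul_assoc)

lemma adj2_sl2_conj: "adj2 (sl2_conj P A) = sl2_conj P (adj2 A)"
  by (simp add: sl2_conj_def adj2_mult matrix_mul_assoc)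

lemma sl2_conj_sl2_conj: "sl2_conj P (sl2_conj Q A) = sl2_conj (Q ** P) A"
  by (simp add: sl2_conj_def adj2_mult matrix_mul_assoc)

lemma sl2_conj_mat1 [simp]: "sl2_conj (mat 1) A = A"
  by (simp add: sl2_conj_def)

lemma sl2_conj_inverse: "det P = 1 \<Longrightarrow> sl2_conj (adj2 P) (sl2_conj P A) = A" "det P = 1 \<Longrightarrow> sl2_conj P (sl2_conj (adj2 P) A) = A"
  by (simp_all add: sl2_conj_sl2_conj adj2_left adj2_right)

lemma det_sl2_conj [simp]: "det P = 1 \<Longrightarrow> det (sl2_conj P A) = det A"
  by (simp add: sl2_conj_def det_mul)

lemma trace_sl2_conj [simp]: "det P = 1 \<Longrightarrow> trace (sl2_conj P A) = trace A"
  by (simp add: sl2_conj_def trace_conj2)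

lemma sl2_conj_one: "det P = 1 \<Longrightarrow> sl2_conj P (mat 1) = mat 1" "det P = 1 \<Longrightarrow> sl2_conj P (- mat 1) = - mat 1"
  by (simp_all add: sl2_conj_def adj2_left mult_uminus_left2 mult_uminus_right2)

lemma pm_one_sl2_conj [simp]:
  assumes "det P = 1"
  shows "pm_one (sl2_conj P A) \<longleftrightarrow> pm_one A"
  using sl2_conj_one[OF assms] sl2_conj_one[of "adj2 P"] sl2_conj_inverse(1)[OF assms, of A] assms
  unfolding pm_one_def by (metis det_adj2)

lemma noncentral_sl2_conj [simp]: "det P = 1 \<Longrightarrow> noncentral (sl2_conj P A) \<longleftrightarrow> noncentral A"
  by (simp add: noncentral_def)

lemma sl2_engel_sl2_conj: "det P = 1 \<Longrightarrow> sl2_engel (sl2_conj P A) n (sl2_conj P B) = sl2_conj P (sl2_engel A n B)"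
  by (induction n) (simp_all add: adj2_sl2_conj sl2_conj_mult)

lemma sl2_arc_sl2_conj: "det P = 1 \<Longrightarrow> sl2_arc n (sl2_conj P A) (sl2_conj P B) \<longleftrightarrow> sl2_arc n A B"
  by (simp add: sl2_arc_def sl2_engel_sl2_conj)

lemma sl2_reach_sl2_conj:
  assumes "det P = 1" "sl2_reach n A B"
  shows "sl2_reach n (sl2_conj P A) (sl2_conj P B)"
  using assms(2)
proof (induction rule: rtranclp_induct)
  case (step B C)
  then show ?case
    using sl2_arc_sl2_conj[OF assms(1), of n B C] by (meson rtranclp.rtrancl_into_rtrancl)
qed simp

lemma sl2_arc_mono:
  assumes "sl2_arc m A B" "m \<le> n"
  shows "sl2_arc n A B"
  using assms pm_one_sl2_engel_mono[of A m B n] by (auto simp: sl2_arc_def noncentral_def)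

lemma sl2_arc_commutes:
  assumes "noncentral A" "noncentral B" "commutes A B" "n \<ge> 1"
  shows "sl2_arc n A B"
proof (rule sl2_arc_mono)
  show "sl2_arc 1 A B"
    using assms pm_one_sl2_engel_one_iff[of A B] unfolding sl2_arc_def noncentral_def by blast
qed fact

section \<open>Conjugacy types of noncentral matrices\<close>

lemma ex_upper_triangular:
  assumes two: "(2::'a::field) \<noteq> 0" and det: "det A = (1::'a)" and sq: "square ((trace A) ^ 2 - 4)"
  shows "\<exists>P r b. det P = 1 \<and> r \<noteq> 0 \<and> A = sl2_conj P (mat2 r b 0 (1 / r))"
proof (cases A rule: mat2_cases)
  case A: (mat2 a b c d)
  have detA: "a * d - b * c = 1"
    using det by (simp add: A)
  show ?thesis
  proof (cases "c = 0")
    case True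
    then have "a * d = 1"
      using detA by simp
    then have "a \<noteq> 0" "d = 1 / a"
      by (auto simp: eq_divide_eq mult.commute)
    show ?thesis
    proof (intro exI conjI)
      show "A = sl2_conj (mat 1) (mat2 a b 0 (1 / a))"
        using \<open>d = 1 / a\<close> by (simp add: A True)
    qed (use \<open>a \<noteq> 0\<close> in simp_all)
  next
    case False
    obtain y where y: "(a + d) ^ 2 - 4 = y ^ 2"
      using sq by (auto simp: A square_def)
    define r where "r = (a + d + y) / 2"
    have ry: "2 * r = a + d + y"
      using two by (simp add: r_def)
    have "(2 * 2) * (r * r - (a + d) * r + 1) = (2 * r) ^ 2 - 2 * (a + d) * (2 * r) + 4"
      by (simp add: power2_eq_square algebra_simps)
    also have "\<dots> = y ^ 2 - (a + d) ^ 2 + 4"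
      unfolding ry by (simp add: power2_eq_square algebra_simps)
    also have "\<dots> = 0"
      by (simp flip: y)
    finally have r: "r * r - (a + d) * r + 1 = 0"
      using two by (auto simp only: mult_eq_0_iff)
    then have r1: "r * (a + d - r) = 1"
      by (simp add: algebra_simps)
    then have r0: "r \<noteq> 0"
      by auto
    have r2: "1 / r = a + d - r"
      using r1 r0 by (simp add: field_simps)
    \<comment> \<open>The first column is an eigenvector for \<open>r\<close>; the second makes the
      determinant one.\<close>
    define P where "P = mat2 (r - d) (- 1 / c) c 0"
    have P: "det P = 1"
      using False by (simp add: P_def)
    have "(r - d) * (r - a) = r * r - (a + d) * r + 1 + (a * d - b * c) - 1 + b * c"
      by (simp add: algebra_simps)
    then have bc: "(r - d) * (r - a) = b * c"
      unfolding r detA by simp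
    have "sl2_conj P A = mat2 r (- 1 / c) (c * ((r - d) * (r - a) - b * c)) (a + d - r)"
      using False by (simp add: P_def A sl2_conj_def field_simps)
    then have "sl2_conj P A = mat2 r (- 1 / c) 0 (a + d - r)"
      by (simp add: bc)
    then have "A = sl2_conj (adj2 P) (mat2 r (- 1 / c) 0 (1 / r))"
      unfolding r2 using sl2_conj_inverse(1)[OF P, of A] by simp
    then show ?thesis
      using P r0 by (metis det_adj2)
  qed
qed

text \<open>The discriminant of the characteristic polynomial separates no eigenvalue in the field,
  two eigenvalues, and a double one; \<open>unipotent\<close> is meant up to the sign
  \<open>e\<close>.\<close>

lemma sl2_cases [consumes 2, case_names irreducible split unipotent]:
  assumes two: "(2::'a::field) \<noteq> 0" and A: "noncentral A"
  obtains "\<not> square ((trace A) ^ 2 - 4)"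
    | P r where "det P = 1" "r \<noteq> 0" "r ^ 2 \<noteq> (1::'a)" "A = sl2_conj P (mat2 r 0 0 (1 / r))"
    | P e s where "det P = 1" "e ^ 2 = 1" "s \<noteq> 0" "A = sl2_conj P (mat2 e s 0 e)"
proof (cases "square ((trace A) ^ 2 - 4)")
  case True
  obtain P r b where P: "det P = 1" "r \<noteq> 0" "A = sl2_conj P (mat2 r b 0 (1 / r))"
    using ex_upper_triangular[OF two _ True] A by (auto simp: noncentral_def)
  show ?thesis
  proof (cases "r ^ 2 = 1")
    case r: True
    then have "1 / r = r"
      using P(2) by (simp add: field_simps power2_eq_square)
    have "b \<noteq> 0"
    proof
      assume "b = 0"
      then have "pm_one (mat2 r b 0 (1 / r))"
        using r \<open>1 / r = r\<close> by (auto simp: pm_one_def mat_eq_mat2 power2_eq_1_iff)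
      then show False
        using A P by (simp add: noncentral_def)
    qed
    then show ?thesis
      using P r that(3)[of P r b] \<open>1 / r = r\<close> by simp
  next
    case r: False
    \<comment> \<open>Conjugation by the unipotent with entry \<open>s\<close> creates exactly the
      off-diagonal entry \<open>b\<close>.\<close>
    define s where "s = b / (r - 1 / r)"
    have "r - 1 / r \<noteq> 0"
      using r P(2) by (simp add: field_simps power2_eq_square)
    then have s: "s * (r - 1 / r) = b"
      by (simp add: s_def)
    have "sl2_conj (mat2 1 s 0 1) (mat2 r 0 0 (1 / r)) = mat2 r (s * (r - 1 / r)) 0 (1 / r)"
      using P(2) by (simp add: sl2_conj_def field_simps)
    then have "A = sl2_conj (mat2 1 s 0 1 ** P) (mat2 r 0 0 (1 / r))"
      unfolding s P(3) sl2_conj_sl2_conj[symmetric] by simp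
    then show ?thesis
      using that(2)[of "mat2 1 s 0 1 ** P" r] P r by (simp add: det_mul)
  qed
qed (rule that(1))

lemma noncentral_unipotent: "e ^ 2 = (1::'a::field) \<Longrightarrow> s \<noteq> 0 \<Longrightarrow> noncentral (mat2 e s 0 e)"
  by (auto simp: noncentral_def pm_one_def mat_eq_mat2 power2_eq_square)

lemma noncentral_diag: "r \<noteq> 0 \<Longrightarrow> r ^ 2 \<noteq> (1::'a::field) \<Longrightarrow> noncentral (mat2 r b 0 (1 / r))"
  by (auto simp: noncentral_def pm_one_def mat_eq_mat2)

section \<open>Involutions of the quotient and paths through them\<close>

definition involutory :: "'a::field ^ 2 ^ 2 \<Rightarrow> bool" where
  "involutory Y \<longleftrightarrow> det Y = 1 \<and> trace Y = 0"

lemma involutory_sl2_conj [simp]: "det P = 1 \<Longrightarrow> involutory (sl2_conj P Y) \<longleftrightarrow> involutory Y"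
  by (simp add: involutory_def)

lemma involutory_mat2: "involutory (mat2 a b c d) \<longleftrightarrow> d = - a \<and> - (a * a) - b * c = (1::'a::field)"
proof -
  have "a + d = 0 \<longleftrightarrow> d = - a"
    by (auto simp: eq_neg_iff_add_eq_0 add.commute)
  then show ?thesis
    by (auto simp: involutory_def)
qed

context
  assumes two: "(2::'a::field) \<noteq> 0"
begin

lemma noncentral_involutory: "involutory (Y :: 'a ^ 2 ^ 2) \<Longrightarrow> noncentral Y"
  using two by (auto simp: noncentral_def involutory_def pm_one_def mat_eq_mat2)

lemma sl2_arc_if_commutes_conj:
  fixes A B :: "'a ^ 2 ^ 2"
  assumes "noncentral A" "noncentral B" "trace B \<noteq> 0" "n \<ge> 2" "commutes (adj2 A ** B ** A) B"
  shows "sl2_arc n A B"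
  using assms pm_one_sl2_engel_iff_commutes_conj[OF two, of A B n] by (auto simp: sl2_arc_def noncentral_def)

lemma sl2_arc_to_involutory:
  fixes A Y :: "'a ^ 2 ^ 2"
  assumes "noncentral A" "involutory Y" "Suc i < n"
    and "(trace_sq ^^ i) ((trace A) ^ 2 + (trace (A ** Y)) ^ 2 - 2) = 0"
  shows "sl2_arc n A Y"
proof -
  obtain k where k: "n = Suc k"
    using less_imp_Suc_add[OF assms(3)] by auto
  then show ?thesis
    using pm_one_sl2_engel_involution_iff[OF two, of A Y k] assms noncentral_involutory[OF assms(2)]
    by (auto simp: sl2_arc_def noncentral_def involutory_def)
qed

text \<open>Upper triangular matrices normalize the abelian group of unipotents.\<close>

lemma sl2_arc_borel_unipotent:
  assumes "noncentral (mat2 r b 0 w)" "e ^ 2 = (1::'a)" "s \<noteq> 0" "n \<ge> 2"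
  shows "sl2_arc n (mat2 r b 0 w) (mat2 e s 0 e)"
proof (rule sl2_arc_if_commutes_conj)
  show "trace (mat2 e s 0 e) \<noteq> 0"
    using assms(2) two by (auto simp flip: mult_2)
  have "r * w = 1"
    using assms(1) by (simp add: noncentral_def)
  then show "commutes (adj2 (mat2 r b 0 w) ** mat2 e s 0 e ** mat2 r b 0 w) (mat2 e s 0 e)"
    by (simp add: commutes_mat2_iff algebra_simps)
qed (use assms in \<open>simp_all add: noncentral_unipotent\<close>)

text \<open>Origin of 2 + d^2: the unipotent has trace 2 e with square 4, its product with the
  involution has trace s c = d, and 4 + d^2 - 2 is the trace of their commutator.\<close>

lemma sl2_arc_unipotent_involutory:
  assumes "e ^ 2 = (1::'a)" "involutory (mat2 a b c (- a))" "s * c = d" "d \<noteq> 0"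
    and "(trace_sq ^^ i) (2 + d ^ 2) = 0" "Suc i < n"
  shows "sl2_arc n (mat2 e s 0 e) (mat2 a b c (- a))"
proof (rule sl2_arc_to_involutory)
  have "(e + e) ^ 2 = 4 * e ^ 2"
    by (simp add: power2_eq_square algebra_simps)
  then show "(trace_sq ^^ i) ((trace (mat2 e s 0 e)) ^ 2 + (trace (mat2 e s 0 e ** mat2 a b c (- a))) ^ 2 - 2) = 0"
    using assms(1,5) by (simp add: assms(3))
qed (use assms in \<open>auto simp: noncentral_unipotent\<close>)

lemma sl2_reach_all:
  assumes "\<And>A :: 'a ^ 2 ^ 2. noncentral A \<Longrightarrow> \<exists>Y. involutory Y \<and> sl2_reach n A Y"
    and "\<And>A :: 'a ^ 2 ^ 2. noncentral A \<Longrightarrow> \<exists>Y. involutory Y \<and> sl2_reach n Y A"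
    and "\<And>Y Y' :: 'a ^ 2 ^ 2. involutory Y \<Longrightarrow> involutory Y' \<Longrightarrow> sl2_reach n Y Y'"
    and "noncentral A" "noncentral (B :: 'a ^ 2 ^ 2)"
  shows "sl2_reach n A B"
  by (meson assms rtranclp_trans)

text \<open>As -1 is a nonsquare, no involution is upper triangular. This turns the upper unipotents
  into a hub: every involution reaches all of them through a split torus, provided by
  \<open>r\<close>, and is entered from the one whose entry is d/c.\<close>

lemma sl2_connected_if_not_square_minus_one:
  fixes A B :: "'a ^ 2 ^ 2"
  assumes m1: "\<not> square (- 1 :: 'a)"
    and sq: "\<And>x y :: 'a. \<not> square x \<Longrightarrow> \<not> square y \<Longrightarrow> square (x * y)"
    and r: "r \<noteq> 0" "r ^ 2 \<noteq> (1::'a)"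
    and d: "(trace_sq ^^ i) (2 + d ^ 2) = (0::'a)" "Suc i < n"
    and "noncentral A" "noncentral B"
  shows "sl2_reach n A B"
proof -
  have n2: "n \<ge> 2"
    using d(2) by simp
  have d0: "d \<noteq> 0"
    using d(1) two trace_sq_iter_two[of i, where 'a='a] by auto
  have inv_c: "c \<noteq> 0" if "involutory (mat2 a b c (- a))" for a b c :: 'a
  proof
    assume "c = 0"
    then have "- (a * a) = 1"
      using that by (simp add: involutory_mat2)
    then have "- 1 = a ^ 2"
      by (metis minus_minus power2_eq_square)
    then show False
      using m1 by (auto simp: square_def)
  qed
  have tr_diag: "x + 1 / x \<noteq> 0" if "x \<noteq> 0" for x :: 'a
  proof
    assume "x + 1 / x = 0"
    then have "x ^ 2 + 1 = 0"
      using that by (simp add: field_simps power2_eq_square)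
    then have "- 1 = x ^ 2"
      by (metis add.commute add_eq_0_iff)
    then show False
      using m1 by (auto simp: square_def)
  qed
  have inv_unip: "sl2_reach n Y (mat2 e s 0 e)" if Y: "involutory Y" and es: "e ^ 2 = 1" "s \<noteq> 0" for Y and e s :: 'a
  proof (cases Y rule: mat2_cases)
    case (mat2 a b c d')
    then have Y': "Y = mat2 a b c (- a)" and detY: "- (a * a) - b * c = 1"
      using Y by (auto simp: involutory_mat2)
    then have c: "c \<noteq> 0"
      using inv_c[of a b c] Y by simp
    \<comment> \<open>Makes the trace of \<open>?T ** Y\<close> vanish, so that Y inverts the upper
      triangular \<open>?T\<close>.\<close>
    define x where "x = (a / r - r * a) / c"
    have x: "c * x = a / r - r * a"
      using c by (simp add: x_def)
    let ?T = "mat2 r x 0 (1 / r)"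
    have T: "noncentral ?T"
      using r by (simp add: noncentral_diag)
    have "?T ** Y = Y ** adj2 ?T"
      using x r(1) by (simp add: Y' algebra_simps)
    then have "adj2 Y ** ?T ** Y = adj2 ?T"
      using Y by (simp add: involutory_def adj2_left_assoc flip: matrix_mul_assoc)
    then have "commutes (adj2 Y ** ?T ** Y) ?T"
      by (simp only: commutes_adj2_iff) (simp add: commutes_def)
    then have "sl2_arc n Y ?T"
      using T tr_diag[OF r(1)] noncentral_involutory[OF Y] n2 by (intro sl2_arc_if_commutes_conj) auto
    moreover have "sl2_arc n ?T (mat2 e s 0 e)"
      using T es n2 by (rule sl2_arc_borel_unipotent)
    ultimately show ?thesis
      by (meson converse_rtranclp_into_rtranclp r_into_rtranclp)
  qed
  have unip_inv: "sl2_reach n (mat2 1 (d / c) 0 1) (mat2 a b c (- a))"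
    if "involutory (mat2 a b c (- a))" for a b c :: 'a
    by (rule r_into_rtranclp, rule sl2_arc_unipotent_involutory[of _ _ _ _ _ d i]) (use inv_c[OF that] d d0 that in auto)
  have unip_inv': "sl2_reach n (mat2 e s 0 e) (mat2 0 (- s / d) (d / s) (- 0))" if "e ^ 2 = 1" "s \<noteq> 0" for e s :: 'a
    by (rule r_into_rtranclp, rule sl2_arc_unipotent_involutory[of _ _ _ _ _ d i])
      (use d d0 that in \<open>auto simp: involutory_mat2\<close>)
  \<comment> \<open>The involution of the nonsplit torus of A is its traceless part 2 A - tr A,
    rescaled by a root of 4 - (tr A)^2, which is a square because -1 is not.\<close>
  have irr: "\<exists>Y. involutory Y \<and> commutes A Y" if "\<not> square ((trace A) ^ 2 - 4)" "det A = 1" for A :: "'a ^ 2 ^ 2"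
  proof (cases A rule: mat2_cases)
    case A: (mat2 a b c d)
    have "square (- 1 * ((a + d) ^ 2 - 4))"
      using that m1 by (intro sq) (auto simp: A)
    then obtain y where y: "4 - (a + d) ^ 2 = y ^ 2"
      by (auto simp: square_def)
    have "square (0::'a)"
      using square_power2[of "0::'a"] by simp
    then have "y \<noteq> 0"
      using that y by (auto simp: A)
    have "a * d - b * c = 1"
      using that by (simp add: A)
    then have "y ^ 2 = 4 * (a * d - b * c) - (a + d) ^ 2"
      by (simp flip: y)
    then have "- ((a - d) * (a - d)) - 4 * (b * c) = y * y"
      by (simp add: power2_eq_square algebra_simps)
    then have "involutory (mat2 ((a - d) / y) (2 * b / y) (2 * c / y) (- ((a - d) / y)))"
      using \<open>y \<noteq> 0\<close> by (simp add: involutory_mat2) (simp add: field_simps)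
    moreover have "commutes A (mat2 ((a - d) / y) (2 * b / y) (2 * c / y) (- ((a - d) / y)))"
      using \<open>y \<noteq> 0\<close> by (simp add: A commutes_mat2_iff field_simps)
    ultimately show ?thesis
      by blast
  qed
  show ?thesis
  proof (rule sl2_reach_all)
    fix A :: "'a ^ 2 ^ 2" assume "noncentral A"
    with two show "\<exists>Y. involutory Y \<and> sl2_reach n A Y"
    proof (cases rule: sl2_cases)
      case irreducible
      then obtain Y where "involutory Y" "commutes A Y"
        using irr \<open>noncentral A\<close> by (auto simp: noncentral_def)
      then show ?thesis
        using \<open>noncentral A\<close> noncentral_involutory n2 by (meson sl2_arc_commutes r_into_rtranclp one_le_numeral order_trans)
    next
      case (split P r)
      have "sl2_reach n (mat2 r 0 0 (1 / r)) (mat2 0 (- 1 / d) (d / 1) (- 0))"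
        using unip_inv'[of 1 1] sl2_arc_borel_unipotent[OF noncentral_diag[OF split(2,3)], of 1 1 n 0] n2
        by (simp add: converse_rtranclp_into_rtranclp)
      then show ?thesis
        using split d0 by (intro exI[of _ "sl2_conj P (mat2 0 (- 1 / d) (d / 1) (- 0))"]) (simp add: sl2_reach_sl2_conj involutory_mat2)
    next
      case (unipotent P e s)
      then show ?thesis
        using unip_inv'[of e s] d0
        by (intro exI[of _ "sl2_conj P (mat2 0 (- s / d) (d / s) (- 0))"]) (simp add: sl2_reach_sl2_conj involutory_mat2)
    qed
  next
    fix A :: "'a ^ 2 ^ 2" assume "noncentral A"
    let ?W = "mat2 0 1 (- 1) 0 :: 'a ^ 2 ^ 2"
    have W: "involutory ?W"
      by (simp add: involutory_mat2)
    from two \<open>noncentral A\<close> show "\<exists>Y. involutory Y \<and> sl2_reach n Y A"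
    proof (cases rule: sl2_cases)
      case irreducible
      then obtain Y where "involutory Y" "commutes A Y"
        using irr \<open>noncentral A\<close> by (auto simp: noncentral_def)
      then show ?thesis
        using \<open>noncentral A\<close> noncentral_involutory n2
        by (meson sl2_arc_commutes commutes_sym r_into_rtranclp one_le_numeral order_trans)
    next
      case (split P r)
      have "sl2_arc n ?W (mat2 r 0 0 (1 / r))"
        using noncentral_diag[OF split(2,3)] tr_diag[OF split(2)] noncentral_involutory[OF W] n2
        by (intro sl2_arc_if_commutes_conj) (auto simp: commutes_mat2_iff)
      then show ?thesis
        using split W by (intro exI[of _ "sl2_conj P ?W"]) (simp add: sl2_arc_sl2_conj r_into_rtranclp)
    next
      case (unipotent P e s)
      then show ?thesis
        using inv_unip[OF W] W by (intro exI[of _ "sl2_conj P ?W"]) (simp add: sl2_reach_sl2_conj)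
    qed
  next
    fix Y Y' :: "'a ^ 2 ^ 2" assume Y: "involutory Y" "involutory Y'"
    obtain a b c where Y': "Y' = mat2 a b c (- a)"
      using Y(2) by (cases Y' rule: mat2_cases) (auto simp: involutory_mat2)
    then have "sl2_reach n Y (mat2 1 (d / c) 0 1)"
      using inv_unip[OF Y(1), of 1 "d / c"] inv_c Y d0 by auto
    then show "sl2_reach n Y Y'"
      using unip_inv[of a b c] Y unfolding Y' by simp
  qed fact+
qed

text \<open>An irreducible matrix has nonzero lower left entry, so the trace of its product with
  these triangular involutions is a nonconstant affine function of \<open>y\<close>.\<close>

lemma ex_involutory_trace_mult:
  fixes A :: "'a ^ 2 ^ 2"
  assumes "\<not> square ((trace A) ^ 2 - 4)" "det A = 1" "\<iota> ^ 2 = (- 1 :: 'a)"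
  shows "\<exists>y. involutory (mat2 \<iota> y 0 (- \<iota>)) \<and> trace (A ** mat2 \<iota> y 0 (- \<iota>)) = \<beta>"
proof (cases A rule: mat2_cases)
  case A: (mat2 a b c d)
  have "c \<noteq> 0"
  proof
    assume "c = 0"
    then have "(trace A) ^ 2 - 4 = (a + d) ^ 2 - 4 * (a * d)"
      using assms(2) by (simp add: A)
    also have "\<dots> = (a - d) ^ 2"
      by (simp add: power2_eq_square algebra_simps)
    finally show False
      using assms(1) by simp
  qed
  define y where "y = (\<beta> - \<iota> * (a - d)) / c"
  have "y * c = \<beta> - \<iota> * (a - d)"
    using \<open>c \<noteq> 0\<close> by (simp add: y_def)
  then show ?thesis
    using assms(3) by (intro exI[of _ y]) (simp add: involutory_mat2 A power2_eq_square algebra_simps)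
qed

lemma sl2_connected_if_square_minus_one:
  fixes A B :: "'a ^ 2 ^ 2"
  assumes \<iota>: "\<iota> ^ 2 = (- 1 :: 'a)"
    and d: "2 + d ^ 2 = (0::'a)"
    and irr: "\<And>A :: 'a ^ 2 ^ 2. det A = 1 \<Longrightarrow> \<not> square ((trace A) ^ 2 - 4) \<Longrightarrow>
      \<exists>Y. involutory Y \<and> sl2_reach n A Y"
    and n2: "n \<ge> 2" and "noncentral A" "noncentral B"
  shows "sl2_reach n A B"
proof -
  have d0: "d \<noteq> 0"
    using d two by auto
  have i0: "\<iota> \<noteq> 0"
    using \<iota> by auto
  have unip_inv: "sl2_reach n (mat2 1 (d / c) 0 1) (mat2 a b c (- a))"
    if "involutory (mat2 a b c (- a))" "c \<noteq> 0" for a b c :: 'a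
    by (rule r_into_rtranclp, rule sl2_arc_unipotent_involutory[of _ _ _ _ _ d 0]) (use d d0 that n2 in auto)
  have unip_inv': "sl2_reach n (mat2 e s 0 e) (mat2 0 (- s / d) (d / s) (- 0))" if "e ^ 2 = 1" "s \<noteq> 0" for e s :: 'a
    by (rule r_into_rtranclp, rule sl2_arc_unipotent_involutory[of _ _ _ _ _ d 0])
      (use d d0 that n2 in \<open>auto simp: involutory_mat2\<close>)
  have diag_inv: "sl2_reach n (mat2 r 0 0 (- r)) (mat2 a b c (- a))"
    if "r ^ 2 = - 1" "involutory (mat2 a b c (- a))" "c \<noteq> 0" for r a b c :: 'a
  proof -
    have "noncentral (mat2 r 0 0 (- r))"
      using that by (intro noncentral_involutory) (simp add: involutory_mat2 power2_eq_square)
    then have "sl2_arc n (mat2 r 0 0 (- r)) (mat2 1 (d / c) 0 1)"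
      using that d0 n2 by (intro sl2_arc_borel_unipotent) auto
    then show ?thesis
      using unip_inv[OF that(2,3)] by (rule converse_rtranclp_into_rtranclp)
  qed
  let ?I = "mat2 \<iota> 0 0 (- \<iota>)"
  have I: "involutory ?I"
    using \<iota> by (simp add: involutory_mat2 power2_eq_square)
  show ?thesis
  proof (rule sl2_reach_all)
    fix A :: "'a ^ 2 ^ 2" assume "noncentral A"
    with two show "\<exists>Y. involutory Y \<and> sl2_reach n A Y"
    proof (cases rule: sl2_cases)
      case irreducible
      then show ?thesis
        using irr \<open>noncentral A\<close> by (auto simp: noncentral_def)
    next
      case (split P r)
      have "sl2_reach n (mat2 r 0 0 (1 / r)) (mat2 0 (- 1 / d) (d / 1) (- 0))"
        using unip_inv'[of 1 1] sl2_arc_borel_unipotent[OF noncentral_diag[OF split(2,3)], of 1 1 n 0] n2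
        by (simp add: converse_rtranclp_into_rtranclp)
      then show ?thesis
        using split d0 by (intro exI[of _ "sl2_conj P (mat2 0 (- 1 / d) (d / 1) (- 0))"]) (simp add: sl2_reach_sl2_conj involutory_mat2)
    next
      case (unipotent P e s)
      then show ?thesis
        using unip_inv'[of e s] d0
        by (intro exI[of _ "sl2_conj P (mat2 0 (- s / d) (d / s) (- 0))"]) (simp add: sl2_reach_sl2_conj involutory_mat2)
    qed
  next
    fix A :: "'a ^ 2 ^ 2" assume "noncentral A"
    from two \<open>noncentral A\<close> show "\<exists>Y. involutory Y \<and> sl2_reach n Y A"
    proof (cases rule: sl2_cases)
      case irreducible
      \<comment> \<open>Trace 0 of the product means that the involution inverts A.\<close>
      then obtain y where y: "involutory (mat2 \<iota> y 0 (- \<iota>))" "trace (A ** mat2 \<iota> y 0 (- \<iota>)) = 0"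
        using ex_involutory_trace_mult[of A \<iota> 0] \<iota> \<open>noncentral A\<close> by (auto simp: noncentral_def)
      have "trace A \<noteq> 0"
      proof
        assume "trace A = 0"
        then have "(trace A) ^ 2 - 4 = (2 * \<iota>) ^ 2"
          using \<iota> by (simp add: power_mult_distrib)
        then show False
          using irreducible square_power2 by metis
      qed
      let ?Y = "mat2 \<iota> y 0 (- \<iota>)"
      have "A ** ?Y = ?Y ** adj2 A"
      proof (cases A rule: mat2_cases)
        case (mat2 a b c d)
        have "\<iota> * a + y * c - \<iota> * d = 0"
          using y(2) by (simp add: mat2 algebra_simps)
        then show ?thesis
          by (simp add: mat2 algebra_simps)
      qed
      then have "adj2 ?Y ** A ** ?Y = adj2 A"
        using y(1) by (simp add: involutory_def adj2_left_assoc del: adj2_mat2 mat2_mult flip: matrix_mul_assoc)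
      then have "commutes (adj2 ?Y ** A ** ?Y) A"
        by (simp only: commutes_adj2_iff) (simp add: commutes_def)
      then have "sl2_arc n ?Y A"
        using \<open>noncentral A\<close> \<open>trace A \<noteq> 0\<close> noncentral_involutory[OF y(1)] n2 by (intro sl2_arc_if_commutes_conj)
      then show ?thesis
        using y(1) by blast
    next
      case (split P r)
      have "sl2_arc n ?I (mat2 r 0 0 (1 / r))"
        using noncentral_diag[OF split(2,3)] noncentral_involutory[OF I] n2
        by (intro sl2_arc_commutes) (auto simp: commutes_mat2_iff)
      then show ?thesis
        using split I by (intro exI[of _ "sl2_conj P ?I"]) (simp add: sl2_arc_sl2_conj r_into_rtranclp)
    next
      case (unipotent P e s)
      have "sl2_arc n ?I (mat2 e s 0 e)"
        using noncentral_involutory[OF I] unipotent n2 by (intro sl2_arc_borel_unipotent)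
      then show ?thesis
        using unipotent I by (intro exI[of _ "sl2_conj P ?I"]) (simp add: sl2_arc_sl2_conj r_into_rtranclp)
    qed
  next
    fix Y Y' :: "'a ^ 2 ^ 2" assume Y: "involutory Y" "involutory Y'"
    \<comment> \<open>Since -4 is a square, every involution is diagonalizable, and the start of the
      path may be taken diagonal.\<close>
    obtain P r where P: "det P = 1" "r ^ 2 = - 1" "Y = sl2_conj P (mat2 r 0 0 (- r))"
    proof -
      have "(trace Y) ^ 2 - 4 = (2 * \<iota>) ^ 2"
        using \<iota> Y by (simp add: power_mult_distrib involutory_def)
      then have sq: "square ((trace Y) ^ 2 - 4)"
        using square_power2 by metis
      from two noncentral_involutory[OF Y(1)] show ?thesis
      proof (cases rule: sl2_cases)
        case irreducible
        with sq show ?thesis by simp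
      next
        case (split P r)
        then have "r + 1 / r = 0"
          using Y(1) by (simp add: involutory_def)
        then have "1 / r = - r"
          by (simp add: eq_neg_iff_add_eq_0 add.commute)
        moreover from this have "r ^ 2 = - 1"
          using split(2) by (simp add: field_simps power2_eq_square) (metis minus_minus)
        ultimately show ?thesis
          using split that by simp
      next
        case (unipotent P e s)
        then have "2 * e = 0"
          using Y(1) by (simp add: involutory_def)
        then show ?thesis
          using unipotent two by simp
      qed
    qed
    obtain a b c where Z: "sl2_conj (adj2 P) Y' = mat2 a b c (- a)" "involutory (mat2 a b c (- a))"
      using Y(2) P(1) involutory_sl2_conj[of "adj2 P" Y']
      by (cases "sl2_conj (adj2 P) Y'" rule: mat2_cases) (auto simp: involutory_mat2)
    have diag: "involutory (mat2 r 0 0 (- r))" if "r ^ 2 = - 1" for r :: 'a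
      using that by (simp add: involutory_mat2 power2_eq_square)
    have "sl2_reach n (mat2 r 0 0 (- r)) (mat2 a b c (- a))"
    proof -
      consider "c \<noteq> 0" | "b \<noteq> 0" | "b = 0" "c = 0" by blast
      then show ?thesis
      proof cases
        case 1
        then show ?thesis
          using diag_inv P(2) Z(2) by blast
      next
        case 2
        \<comment> \<open>Conjugation by the Weyl element swaps the off-diagonal entries up to sign,
          which reduces to a nonzero lower left entry.\<close>
        let ?W = "mat2 0 1 (- 1) 0 :: 'a ^ 2 ^ 2"
        have "sl2_reach n (mat2 (- r) 0 0 (- (- r))) (mat2 (- a) (- c) (- b) (- (- a)))"
          using 2 P(2) Z(2) by (intro diag_inv) (auto simp: involutory_mat2 mult.commute)
        then have "sl2_reach n (sl2_conj ?W (mat2 (- r) 0 0 (- (- r)))) (sl2_conj ?W (mat2 (- a) (- c) (- b) (- (- a))))"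
          by (intro sl2_reach_sl2_conj) simp
        then show ?thesis
          by (simp add: sl2_conj_def)
      next
        case 3
        then have "commutes (mat2 r 0 0 (- r)) (mat2 a b c (- a))"
          by (simp add: commutes_mat2_iff)
        then show ?thesis
          using noncentral_involutory[OF diag[OF P(2)]] noncentral_involutory[OF Z(2)] n2
          by (intro r_into_rtranclp sl2_arc_commutes) auto
      qed
    qed
    from sl2_reach_sl2_conj[OF P(1) this] show "sl2_reach n Y Y'"
      unfolding P(3)[symmetric] Z(1)[symmetric] sl2_conj_inverse(2)[OF P(1)] .
  qed fact+
qed

end

subsection \<open>Arcs leaving a unipotent or irreducible matrix\<close>

context
  assumes two: "(2::'a::field) \<noteq> 0"
begin

text \<open>Shows that only the identity is removed from the vertex set. Some conjugate of A has
  nonzero lower left entry; it moves the standard unipotent to one that does not commute with it, so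
  no iterated commutator is central.\<close>

lemma ex_not_engel:
  fixes A :: "'a ^ 2 ^ 2"
  assumes "noncentral A"
  shows "\<exists>B. noncentral B \<and> (\<forall>n. \<not> pm_one (sl2_engel A n B))"
proof -
  let ?U = "mat2 1 1 0 1 :: 'a ^ 2 ^ 2"
  have U: "\<not> pm_one (sl2_engel C n ?U)" if C: "noncentral C" "C $ 2 $ 1 \<noteq> 0" for C :: "'a ^ 2 ^ 2" and n
  proof
    assume "pm_one (sl2_engel C n ?U)"
    \<comment> \<open>Raising the index makes the criterion for at least two commutators applicable
      to every \<open>n\<close>.\<close>
    then have "pm_one (sl2_engel C (n + 2) ?U)"
      by (rule pm_one_sl2_engel_mono) simp_all
    then have "commutes (adj2 C ** ?U ** C) ?U"
      using pm_one_sl2_engel_iff_commutes_conj[OF two, of C ?U "n + 2"] C(1) two by (simp add: noncentral_def)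
    then show False
      using C by (cases C rule: mat2_cases) (auto simp: commutes_mat2_iff algebra_simps)
  qed
  have "\<exists>P. det P = 1 \<and> sl2_conj P A $ 2 $ 1 \<noteq> 0"
  proof (cases A rule: mat2_cases)
    case (mat2 a b c d)
    consider "c \<noteq> 0" | "b \<noteq> 0" | "b = 0" "c = 0" by blast
    then show ?thesis
    proof cases
      case 1
      then show ?thesis
        by (intro exI[of _ "mat 1"]) (simp add: mat2)
    next
      case 2
      then show ?thesis
        by (intro exI[of _ "mat2 0 1 (- 1) 0"]) (simp add: mat2 sl2_conj_def)
    next
      case 3
      then have "d \<noteq> a"
        using assms by (auto simp: mat2 noncentral_def pm_one_def mat_eq_mat2 square_eq_1_iff)
      then show ?thesis
        using 3 by (intro exI[of _ "mat2 1 0 1 1"]) (simp add: mat2 sl2_conj_def)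
    qed
  qed
  then obtain P where P: "det P = 1" "sl2_conj P A $ 2 $ 1 \<noteq> 0" by blast
  have "\<not> pm_one (sl2_engel A n (sl2_conj (adj2 P) ?U))" for n
    using U[of "sl2_conj P A" n] P assms pm_one_sl2_conj[OF P(1), of "sl2_engel A n (sl2_conj (adj2 P) ?U)"]
    by (simp add: sl2_conj_inverse(2) flip: sl2_engel_sl2_conj)
  then show ?thesis
    using P(1) noncentral_unipotent[of 1 "1::'a"] by (intro exI[of _ "sl2_conj (adj2 P) ?U"]) simp
qed

text \<open>The upper unipotents trap all paths unless an involution lets them out, and by the trace
  computation an involution does so only when an iterate of some 2 + d^2 vanishes.\<close>

lemma sl2_arc_from_unipotent:
  fixes B :: "'a ^ 2 ^ 2"
  assumes es: "e ^ 2 = (1::'a)" "s \<noteq> 0" and arc: "sl2_arc n (mat2 e s 0 e) B"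
    and none: "\<And>i d :: 'a. Suc i < n \<Longrightarrow> (trace_sq ^^ i) (2 + d ^ 2) \<noteq> 0" and n2: "n \<ge> 2"
  shows "\<exists>e' s'. e' ^ 2 = 1 \<and> s' \<noteq> 0 \<and> B = mat2 e' s' 0 e'"
proof (cases B rule: mat2_cases)
  case B: (mat2 a b c d)
  let ?A = "mat2 e s 0 e"
  have A: "det ?A = 1"
    using es by (simp add: power2_eq_square)
  have detB: "a * d - b * c = 1"
    using arc by (simp add: sl2_arc_def noncentral_def B)
  have ntB: "\<not> pm_one B"
    using arc by (simp add: sl2_arc_def noncentral_def)
  show ?thesis
  proof (cases "trace B = 0")
    case False
    \<comment> \<open>Because e^2 = 1, the unipotent is \<open>e\<close> times the one with entry
      \<sigma> and ones on the diagonal, so both conjugate alike.\<close>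
    define \<sigma> where "\<sigma> = e * s"
    have "\<sigma> \<noteq> 0"
      using es by (auto simp: \<sigma>_def)
    have comm': "commutes (adj2 ?A ** B ** ?A) B"
      using pm_one_sl2_engel_iff_commutes_conj[OF two, of ?A B n] arc False n2
      by (simp add: sl2_arc_def noncentral_def)
    have eq: "adj2 ?A ** B ** ?A =
      mat2 (e ^ 2 * a - \<sigma> * c) (e ^ 2 * b + \<sigma> * (a - d) - s ^ 2 * c) (e ^ 2 * c) (e ^ 2 * d + \<sigma> * c)"
      by (simp add: B \<sigma>_def power2_eq_square algebra_simps)
    have comm: "commutes (mat2 (a - \<sigma> * c) (b + \<sigma> * (a - d) - s ^ 2 * c) c (d + \<sigma> * c)) (mat2 a b c d)"
      using comm' unfolding eq[unfolded es(1) mult_1_left] unfolding B .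
    then have "(a - \<sigma> * c - (d + \<sigma> * c)) * c = c * (a - d)"
      by (simp add: commutes_mat2_iff)
    then have "2 * (\<sigma> * (c * c)) = 0"
      by (simp add: algebra_simps)
    then have c: "c = 0"
      using two \<open>\<sigma> \<noteq> 0\<close> by simp
    then have "(a - d) * b = (b + \<sigma> * (a - d)) * (a - d)"
      using comm by (simp add: commutes_mat2_iff)
    then have "\<sigma> * ((a - d) * (a - d)) = 0"
      by (simp add: algebra_simps)
    then have "d = a"
      using \<open>\<sigma> \<noteq> 0\<close> by simp
    moreover from this have "a ^ 2 = 1"
      using detB c by (simp add: power2_eq_square)
    moreover have "b \<noteq> 0"
      using ntB calculation c by (auto simp: B pm_one_def mat_eq_mat2 power2_eq_1_iff)
    ultimately show ?thesis
      using c B by blast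
  next
    case True
    then have d: "d = - a"
      by (simp add: B eq_neg_iff_add_eq_0 add.commute)
    obtain k where k: "n = Suc k"
      using n2 by (cases n) auto
    consider "commutes ?A B" | "?A ** B = - (B ** ?A)"
      | i where "i < k" "(trace_sq ^^ i) ((trace ?A) ^ 2 + (trace (?A ** B)) ^ 2 - 2) = 0"
      using pm_one_sl2_engel_involution_iff[OF two A _ True, of k] arc by (auto simp: k sl2_arc_def noncentral_def)
    then show ?thesis
    proof cases
      case 1
      then have "c = 0" "s * (a + a) = 0"
        using es by (simp_all add: B d commutes_mat2_iff)
      then have "a = 0"
        using es two by (simp flip: mult_2)
      then show ?thesis
        using detB \<open>c = 0\<close> by simp
    next
      case 2
      then have "B ** ?A = - (?A ** B)"
        by (metis minus_minus)
      then have "trace ?A = 0"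
        using arc by (intro anticommute_imp_trace_zero[OF two]) (auto simp: sl2_arc_def noncentral_def)
      then show ?thesis
        using es two by (simp flip: mult_2)
    next
      case 3
      have "(e + e) ^ 2 = 4 * e ^ 2"
        by (simp add: power2_eq_square algebra_simps)
      then have "(trace ?A) ^ 2 + (trace (?A ** B)) ^ 2 - 2 = 2 + (s * c) ^ 2"
        unfolding es(1) by (simp add: B d)
      then show ?thesis
        using none[of i "s * c"] 3 k by simp
    qed
  qed
qed

text \<open>A noncentral A commuting with g is l + k g with \<open>k\<close> nonzero: its
  discriminant is that of g times k^2, and both have the same centralizer.\<close>

lemma commutes_irreducible:
  fixes A g :: "'a ^ 2 ^ 2"
  assumes "\<not> square ((trace g) ^ 2 - 4)" "det g = 1" "noncentral A" "commutes g A"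
  shows "\<not> square ((trace A) ^ 2 - 4)"
    and "commutes A B \<Longrightarrow> commutes g B"
proof -
  obtain a b c d where g: "g = mat2 a b c d"
    by (cases g rule: mat2_cases)
  obtain p q r u where A: "A = mat2 p q r u"
    by (cases A rule: mat2_cases)
  have detg: "a * d - b * c = 1" and detA: "p * u - q * r = 1"
    using assms by (simp_all add: g A noncentral_def)
  have "square (0::'a)"
    using square_power2[of "0::'a"] by simp
  have disc: "(x + w) ^ 2 - 4 = (x - w) ^ 2 + 4 * (y * z)" if "x * w - y * z = 1" for x y z w :: 'a
  proof -
    have "(x + w) ^ 2 - 4 * (x * w - y * z) = (x - w) ^ 2 + 4 * (y * z)"
      by (simp add: power2_eq_square algebra_simps)
    then show ?thesis
      by (simp add: that)
  qed
  have ns: "\<not> (b = 0 \<and> c = 0 \<and> a = d)"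
    using assms(1) disc[OF detg] \<open>square 0\<close> by (auto simp: g)
  obtain l k where lk: "p = l + k * a" "q = k * b" "r = k * c" "u = l + k * d"
    using commutes_nonscalar[OF _ ns] assms(4) unfolding g A by metis
  have k: "k \<noteq> 0"
  proof
    assume "k = 0"
    then have "p = u" "q = 0" "r = 0"
      using lk by auto
    then show False
      using assms(3) detA square_eq_1_iff[of u] by (auto simp: A noncentral_def pm_one_def mat_eq_mat2)
  qed
  have "(p + u) ^ 2 - 4 = k ^ 2 * ((a + d) ^ 2 - 4)"
    unfolding disc[OF detg] disc[OF detA] unfolding lk by (simp add: power2_eq_square algebra_simps)
  then have eq: "(trace g) ^ 2 - 4 = ((trace A) ^ 2 - 4) / k ^ 2"
    using k by (simp add: A g)
  show "\<not> square ((trace A) ^ 2 - 4)"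
  proof
    assume "square ((trace A) ^ 2 - 4)"
    then obtain y where "(trace A) ^ 2 - 4 = y ^ 2"
      by (auto simp: square_def)
    then have "(trace g) ^ 2 - 4 = (y / k) ^ 2"
      unfolding eq by (simp add: power_divide)
    then show False
      using assms(1) square_power2 by metis
  qed
  show "commutes g B" if "commutes A B"
  proof (cases B rule: mat2_cases)
    case (mat2 x y z w)
    have "k * (b * z) = k * (c * y)" "k * ((a - d) * y) = k * (b * (x - w))" "k * ((a - d) * z) = k * (c * (x - w))"
      using that unfolding A mat2 commutes_mat2_iff lk by (simp_all add: algebra_simps)
    then show ?thesis
      using k by (simp add: g mat2 commutes_mat2_iff)
  qed
qed

text \<open>With N the traceless part of 2 B, the hypothesis becomes N A = k A N. If k is not 1,
  then A has trace 0 or an eigenvalue in the field; both make its discriminant a square, trace 0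
  because -4 is one.\<close>

lemma irreducible_commutes_if_commutes_conj:
  fixes A B :: "'a ^ 2 ^ 2"
  assumes irr: "\<not> square ((trace A) ^ 2 - 4)" and det: "det A = 1" "det B = 1"
    and m1: "square (- 1 :: 'a)" and comm: "commutes (adj2 A ** B ** A) B"
  shows "commutes A B"
proof (cases B rule: mat2_cases)
  case B: (mat2 a b c d)
  obtain p q r u where A: "A = mat2 p q r u"
    by (cases A rule: mat2_cases)
  define D where "D = adj2 A ** B ** A"
  obtain x y z w where D: "D = mat2 x y z w"
    by (cases D rule: mat2_cases)
  show ?thesis
  proof (cases "b = 0 \<and> c = 0 \<and> a = d")
    case True
    then show ?thesis
      by (simp add: A B commutes_mat2_iff)
  next
    case False
    have "commutes B D"
      using comm by (simp add: D_def commutes_sym)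
    then obtain l k where lk: "x = l + k * a" "y = k * b" "z = k * c" "w = l + k * d"
      using commutes_nonscalar[OF _ False] unfolding B D by metis
    have "trace D = trace B"
      by (simp add: D_def trace_conj2 det)
    then have l2: "2 * l = (a + d) - k * (a + d)"
      by (simp add: D B lk algebra_simps)
    have "A ** D = B ** A"
      by (simp add: D_def matrix_mul_assoc adj2_right det)
    then have AD: "p * x + q * z = a * p + b * r" "p * y + q * w = a * q + b * u"
        "r * x + u * z = c * p + d * r" "r * y + u * w = c * q + d * u"
      by (simp_all add: A B D)
    define x' y' z' where "x' = a - d" and "y' = 2 * b" and "z' = 2 * c"
    have nz: "\<not> (x' = 0 \<and> y' = 0 \<and> z' = 0)"
      using False two by (auto simp: x'_def y'_def z'_def)
    have "x' * p + y' * r = 2 * (a * p + b * r) - (a + d) * p"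
      "x' * q + y' * u = 2 * (a * q + b * u) - (a + d) * q"
      "z' * p - x' * r = 2 * (c * p + d * r) - (a + d) * r"
      "z' * q - x' * u = 2 * (c * q + d * u) - (a + d) * u"
      by (simp_all add: x'_def y'_def z'_def algebra_simps)
    moreover have "2 * (p * x + q * z) - (a + d) * p = k * (p * x' + q * z') + p * (2 * l - ((a + d) - k * (a + d)))"
      "2 * (p * y + q * w) - (a + d) * q = k * (p * y' - q * x') + q * (2 * l - ((a + d) - k * (a + d)))"
      "2 * (r * x + u * z) - (a + d) * r = k * (r * x' + u * z') + r * (2 * l - ((a + d) - k * (a + d)))"
      "2 * (r * y + u * w) - (a + d) * u = k * (r * y' - u * x') + u * (2 * l - ((a + d) - k * (a + d)))"
      by (simp_all add: lk x'_def y'_def z'_def algebra_simps)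
    \<comment> \<open>The four entries of N A = k A N, where N has rows (x', y') and (z',
      -x').\<close>
    ultimately have e: "x' * p + y' * r = k * (p * x' + q * z')" "x' * q + y' * u = k * (p * y' - q * x')"
      "z' * p - x' * r = k * (r * x' + u * z')" "z' * q - x' * u = k * (r * y' - u * x')"
      unfolding l2 AD by simp_all
    have kk: "k = 1"
    proof (rule ccontr)
      assume "k \<noteq> 1"
      define T where "T = p * x' + q * z' + r * y' - u * x'"
      have "T = (x' * p + y' * r) + (z' * q - x' * u)"
        by (simp add: T_def algebra_simps)
      also have "\<dots> = k * T"
        unfolding e by (simp add: T_def algebra_simps)
      finally have "(1 - k) * T = 0"
        by (simp add: algebra_simps)
      then have T: "T = 0"
        using \<open>k \<noteq> 1\<close> by simp
      \<comment> \<open>Polarized Cayley-Hamilton for traceless N: A N + N A = (tr A) N + tr (A N),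
        with \<open>T\<close> the trace of A N.\<close>
      have "(p * x' + q * z') + k * (p * x' + q * z') = T + (p + u) * x'"
        "(p * y' - q * x') + k * (p * y' - q * x') = (p + u) * y'"
        "(r * x' + u * z') + k * (r * x' + u * z') = (p + u) * z'"
        "(r * y' - u * x') + k * (r * y' - u * x') = T - (p + u) * x'"
        unfolding e[symmetric] by (simp_all add: T_def algebra_simps)
      then have f: "(1 + k) * (p * x' + q * z') = (p + u) * x'" "(1 + k) * (p * y' - q * x') = (p + u) * y'"
        "(1 + k) * (r * x' + u * z') = (p + u) * z'" "(1 + k) * (r * y' - u * x') = - ((p + u) * x')"
        unfolding T by (simp_all add: algebra_simps)
      have detA: "p * u - q * r = 1"
        using det by (simp add: A)
      show False
      proof (cases "1 + k = 0")
        case True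
        then have "p + u = 0"
          using f nz by auto
        moreover obtain i :: 'a where "- 1 = i ^ 2"
          using m1 by (auto simp: square_def)
        ultimately have "(trace A) ^ 2 - 4 = (2 * i) ^ 2"
          by (simp add: A power_mult_distrib flip: \<open>- 1 = i ^ 2\<close>)
        then show False
          using irr square_power2 by metis
      next
        case k1: False
        \<comment> \<open>Now A N = \<mu> N, so the nonzero columns of N are eigenvectors of
          A.\<close>
        define \<mu> where "\<mu> = (p + u) / (1 + k)"
        have m: "(p + u) * v = (1 + k) * (\<mu> * v)" for v
          using k1 by (simp add: \<mu>_def)
        have "p * x' + q * z' = \<mu> * x'" "p * y' - q * x' = \<mu> * y'"
          "r * x' + u * z' = \<mu> * z'" "r * y' - u * x' = - (\<mu> * x')"
          using f k1 unfolding m mult_minus_right[symmetric] by (simp_all only: mult_cancel_left simp_thms)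
        then have g: "(p - \<mu>) * x' + q * z' = 0" "(p - \<mu>) * y' - q * x' = 0"
          "r * x' + (u - \<mu>) * z' = 0" "r * y' - (u - \<mu>) * x' = 0"
          by (simp_all add: algebra_simps)
        \<comment> \<open>The characteristic polynomial of A at \<mu>. Its vanishing turns the
          discriminant into the square of 2 \<mu> - tr A.\<close>
        define \<delta> where "\<delta> = (p - \<mu>) * (u - \<mu>) - q * r"
        have "\<delta> * x' = (u - \<mu>) * ((p - \<mu>) * x' + q * z') - q * (r * x' + (u - \<mu>) * z')"
          "\<delta> * y' = (u - \<mu>) * ((p - \<mu>) * y' - q * x') - q * (r * y' - (u - \<mu>) * x')"
          "\<delta> * z' = (p - \<mu>) * (r * x' + (u - \<mu>) * z') - r * ((p - \<mu>) * x' + q * z')"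
          by (simp_all add: \<delta>_def algebra_simps)
        then have "\<delta> = 0"
          unfolding g using nz by auto
        have "(p + u) ^ 2 - 4 * (p * u - q * r) = (2 * \<mu> - (p + u)) ^ 2 - 4 * \<delta>"
          by (simp add: \<delta>_def power2_eq_square algebra_simps)
        then have "(trace A) ^ 2 - 4 = (2 * \<mu> - (p + u)) ^ 2"
          unfolding detA \<open>\<delta> = 0\<close> by (simp add: A)
        then show False
          using irr square_power2 by metis
      qed
    qed
    then have "l = 0"
      using l2 two by simp
    then have "D = B"
      by (simp add: D B lk kk)
    then show ?thesis
      using \<open>A ** D = B ** A\<close> by (simp add: commutes_def)
  qed
qed

text \<open>For n = 2 only the commutator trace itself may vanish, so the sole way out of the torus
  is an involution B with (tr A)^2 + (tr AB)^2 = 2, which \<open>none\<close> forbids.\<close>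

lemma sl2_arc_from_irreducible:
  fixes A B g :: "'a ^ 2 ^ 2"
  assumes g: "\<not> square ((trace g) ^ 2 - 4)" "det g = 1" and A: "commutes g A" and arc: "sl2_arc 2 A B"
    and m1: "square (- 1 :: 'a)"
    and none: "\<And>t b :: 'a. \<not> square (t ^ 2 - 4) \<Longrightarrow> 2 - t ^ 2 \<noteq> b ^ 2"
  shows "commutes g B"
proof -
  have nt: "noncentral A" "noncentral B"
    using arc by (simp_all add: sl2_arc_def)
  then have det: "det A = 1" "det B = 1"
    by (simp_all add: noncentral_def)
  note irr = commutes_irreducible[OF g nt(1) A]
  have "commutes A B"
  proof (cases "trace B = 0")
    case False
    then have "commutes (adj2 A ** B ** A) B"
      using pm_one_sl2_engel_iff_commutes_conj[OF two det, of 2] arc by (simp add: sl2_arc_def)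
    then show ?thesis
      using irreducible_commutes_if_commutes_conj[OF irr(1) det m1] by simp
  next
    case True
    have "commutes A B \<or> A ** B = - (B ** A) \<or> (trace A) ^ 2 + (trace (A ** B)) ^ 2 - 2 = 0"
      using pm_one_sl2_engel_involution_iff[OF two det True, of 1] arc
      by (simp add: sl2_arc_def numeral_2_eq_2 del: sl2_engel.simps)
    moreover have "A ** B \<noteq> - (B ** A)"
    proof
      assume "A ** B = - (B ** A)"
      then have "B ** A = - (A ** B)"
        by (metis minus_minus)
      then have "trace A = 0"
        using det by (intro anticommute_imp_trace_zero[OF two])
      moreover obtain i :: 'a where i: "- 1 = i ^ 2"
        using m1 by (auto simp: square_def)
      ultimately have "(trace A) ^ 2 - 4 = (2 * i) ^ 2"
        by (simp add: power_mult_distrib flip: i)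
      then show False
        using irr(1) square_power2 by metis
    qed
    moreover have "(trace A) ^ 2 + (trace (A ** B)) ^ 2 - 2 \<noteq> 0"
      using none[OF irr(1), of "trace (A ** B)"] by (simp add: algebra_simps)
    ultimately show ?thesis
      by blast
  qed
  then show ?thesis
    by (rule irr(2))
qed

text \<open>Move inside the torus of A to an element of the prescribed trace \<open>t\<close>, from
  which an involution with product trace \<open>b\<close> is one arc away: t^2 + b^2 - 2 =
  0.\<close>

lemma irreducible_reach_involutory:
  fixes A :: "'a ^ 2 ^ 2"
  assumes A: "det A = 1" "\<not> square ((trace A) ^ 2 - 4)" and \<iota>: "\<iota> ^ 2 = (- 1 :: 'a)"
    and t: "\<not> square (t ^ 2 - 4 :: 'a)" "2 - t ^ 2 = b ^ 2"
    and sq: "\<And>x y :: 'a. \<not> square x \<Longrightarrow> \<not> square y \<Longrightarrow> square (x * y)" and n2: "n \<ge> 2"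
  shows "\<exists>Y. involutory Y \<and> sl2_reach n A Y"
proof (cases A rule: mat2_cases)
  case mat2: (mat2 a b' c d)
  have det: "a * d - b' * c = 1"
    using A by (simp add: mat2)
  have sq0: "square (0::'a)"
    using square_power2[of "0::'a"] by simp
  define D where "D = (a + d) ^ 2 - 4"
  have D: "\<not> square D" "D \<noteq> 0"
    using A sq0 by (auto simp: D_def mat2)
  obtain y where y: "(t ^ 2 - 4) * D = y ^ 2"
    using sq[OF t(1) D(1)] by (auto simp: square_def)
  \<comment> \<open>Rescales the traceless part of A so that the discriminant becomes t^2 - 4; the
    ratio of two nonsquares is a square.\<close>
  define k where "k = y / D"
  have k: "k ^ 2 * D = t ^ 2 - 4"
    using y D(2) by (simp add: k_def power_divide power2_eq_square field_simps)
  have disc: "D = (a - d) ^ 2 + 4 * (b' * c)"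
  proof -
    have "(a + d) ^ 2 - 4 * (a * d - b' * c) = (a - d) ^ 2 + 4 * (b' * c)"
      by (simp add: power2_eq_square algebra_simps)
    then show ?thesis
      by (simp add: det D_def)
  qed
  define A' where "A' = mat2 ((t + k * (a - d)) / 2) (k * b') (k * c) ((t - k * (a - d)) / 2)"
  have four: "(4::'a) \<noteq> 0"
    using two by (metis mult_eq_0_iff numeral_Bit0 mult_2)
  have "4 * det A' = (t + k * (a - d)) * (t - k * (a - d)) - 4 * (k * b' * (k * c))"
    using two four by (simp add: A'_def field_simps)
  also have "\<dots> = t ^ 2 - k ^ 2 * ((a - d) ^ 2 + 4 * (b' * c))"
    by (simp add: power2_eq_square algebra_simps)
  also have "\<dots> = 4 * 1"
    unfolding disc[symmetric] k by simp
  finally have det': "det A' = 1"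
    using four by (simp only: mult_cancel_left) simp
  have tr': "trace A' = t"
    using two four by (simp add: A'_def field_simps)
  have nt': "noncentral A'"
  proof -
    have "\<not> pm_one A'"
    proof
      assume "pm_one A'"
      then have "t ^ 2 - 4 = 0"
        by (auto simp: pm_one_def mat_eq_mat2 simp flip: tr')
      then show False
        using t(1) sq0 by simp
    qed
    then show ?thesis
      using det' by (simp add: noncentral_def)
  qed
  have ntA: "noncentral A"
    using A sq0 by (auto simp: noncentral_def pm_one_def mat_eq_mat2)
  have "commutes A A'"
    using two four by (simp add: mat2 A'_def commutes_mat2_iff field_simps)
  then have "sl2_arc n A A'"
    using ntA nt' n2 by (intro sl2_arc_commutes) auto
  moreover obtain w where w: "involutory (mat2 \<iota> w 0 (- \<iota>))" "trace (A' ** mat2 \<iota> w 0 (- \<iota>)) = b"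
    using ex_involutory_trace_mult[of A' \<iota> b] t(1) det' tr' \<iota> two by blast
  have "sl2_arc n A' (mat2 \<iota> w 0 (- \<iota>))"
    by (rule sl2_arc_to_involutory[OF two nt' w(1), of 0]) (use n2 in \<open>auto simp: w(2) tr' simp flip: t(2)\<close>)
  ultimately show ?thesis
    using w(1) by (meson converse_rtranclp_into_rtranclp r_into_rtranclp)
qed

end

subsection \<open>Engel graphs of the quotient\<close>

lemma engel_comm_hom:
  assumes "group_hom G H h" "x \<in> carrier G" "y \<in> carrier G"
  shows "engel_comm G x n y \<in> carrier G" "engel_comm H (h x) n (h y) = h (engel_comm G x n y)"
proof -
  interpret group_hom G H h by fact
  have "engel_comm G x n y \<in> carrier G \<and> engel_comm H (h x) n (h y) = h (engel_comm G x n y)"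
    using assms(2,3) by (induction n) (simp_all add: group_comm_def)
  then show "engel_comm G x n y \<in> carrier G" "engel_comm H (h x) n (h y) = h (engel_comm G x n y)"
    by auto
qed

lemma (in group) group_center_normal: "group_center G \<lhd> G"
proof (rule normal_invI)
  show "subgroup (group_center G) G"
  proof
    fix x y assume "x \<in> group_center G" "y \<in> group_center G"
    then have x: "x \<in> carrier G" "\<And>z. z \<in> carrier G \<Longrightarrow> x \<otimes> z = z \<otimes> x"
      and y: "y \<in> carrier G" "\<And>z. z \<in> carrier G \<Longrightarrow> y \<otimes> z = z \<otimes> y"
      unfolding group_center_def by blast+
    have "x \<otimes> y \<otimes> z = z \<otimes> (x \<otimes> y)" if z: "z \<in> carrier G" for z
      by (metis m_assoc x y z)
    then show "x \<otimes> y \<in> group_center G"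
      using x(1) y(1) by (simp add: group_center_def)
  next
    fix x assume "x \<in> group_center G"
    then have x: "x \<in> carrier G" "\<And>y. y \<in> carrier G \<Longrightarrow> x \<otimes> y = y \<otimes> x"
      unfolding group_center_def by blast+
    have "inv x \<otimes> y = y \<otimes> inv x" if y: "y \<in> carrier G" for y
    proof -
      have "inv x \<otimes> y = inv (inv y \<otimes> x)"
        by (simp add: inv_mult_group x(1) y)
      also have "\<dots> = inv (x \<otimes> inv y)"
        by (simp only: x(2)[OF inv_closed[OF y]])
      also have "\<dots> = y \<otimes> inv x"
        by (simp add: inv_mult_group x(1) y)
      finally show ?thesis .
    qed
    then show "inv x \<in> group_center G"
      using x(1) by (simp add: group_center_def)
  qed (auto simp: group_center_def)
next
  fix x h assume x: "x \<in> carrier G" and h: "h \<in> group_center G"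
  then have "h \<in> carrier G" "x \<otimes> h = h \<otimes> x"
    by (auto simp: group_center_def)
  then have "x \<otimes> h \<otimes> inv x = h"
    using x by (simp add: m_assoc)
  then show "x \<otimes> h \<otimes> inv x \<in> group_center G"
    using h by simp
qed

text \<open>The quotient by the trivial subgroup only wraps elements into singletons, so the upper
  central series never starts to grow.\<close>

lemma (in group) hypercenter_trivial:
  assumes "group_center G = {\<one>}"
  shows "hypercenter G = {\<one>}"
proof -
  have "upper_central G k = {\<one>}" for k
  proof (induction k)
    case (Suc k)
    have "{\<one>} #> g \<in> group_center (G Mod {\<one>}) \<longleftrightarrow> g \<in> group_center G" if g: "g \<in> carrier G" for g
    proof -
      have sing: "{\<one>} #> x = {x}" if "x \<in> carrier G" for x
        using that by (simp add: r_coset_def)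
      have carr: "carrier (G Mod {\<one>}) = (\<lambda>x. {x}) ` carrier G"
        using sing by (auto simp: FactGroup_def RCOSETS_def)
      have mult: "{x} <#> {y} = {x \<otimes> y}" for x y
        by (simp add: set_mult_def)
      show ?thesis
        unfolding sing[OF g] group_center_def carr using g by (auto simp: mult)
    qed
    then have "upper_central G (Suc k) = group_center G"
      using Suc by (auto simp: group_center_def)
    then show ?case
      by (simp add: assms)
  qed simp
  then show ?thesis
    by (auto simp: hypercenter_def)
qed

lemma strongly_connected_simple_digraph_iff:
  "strongly_connected (simple_digraph V R) \<longleftrightarrow>
    V \<noteq> {} \<and> (\<forall>u\<in>V. \<forall>v\<in>V. (\<lambda>x y. x \<in> V \<and> y \<in> V \<and> R x y)\<^sup>*\<^sup>* u v)"
proof -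
  have ends: "arcs_ends (simple_digraph V R) = {(x, y). x \<in> V \<and> y \<in> V \<and> R x y}"
    by (force simp: arcs_ends_def arc_to_ends_def simple_digraph_def)
  have "u \<rightarrow>\<^sup>*\<^bsub>simple_digraph V R\<^esub> v \<longleftrightarrow> (\<lambda>x y. x \<in> V \<and> y \<in> V \<and> R x y)\<^sup>*\<^sup>* u v"
    if "u \<in> V" "v \<in> V" for u v
  proof
    assume "u \<rightarrow>\<^sup>*\<^bsub>simple_digraph V R\<^esub> v"
    then have "(u, v) \<in> rtrancl_on V {(x, y). x \<in> V \<and> y \<in> V \<and> R x y}"
      by (simp add: reachable_def ends) (simp add: simple_digraph_def)
    then show "(\<lambda>x y. x \<in> V \<and> y \<in> V \<and> R x y)\<^sup>*\<^sup>* u v"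
      by (induction rule: rtrancl_on.induct) (auto intro: rtranclp.rtrancl_into_rtrancl)
  next
    assume "(\<lambda>x y. x \<in> V \<and> y \<in> V \<and> R x y)\<^sup>*\<^sup>* u v"
    then have "(u, v) \<in> rtrancl_on V {(x, y). x \<in> V \<and> y \<in> V \<and> R x y}"
      using that(1)
    proof (induction rule: rtranclp_induct)
      case (step y z)
      then show ?case
        by (auto intro: rtrancl_on_into_rtrancl_on)
    qed auto
    then show "u \<rightarrow>\<^sup>*\<^bsub>simple_digraph V R\<^esub> v"
      by (simp add: reachable_def ends) (simp add: simple_digraph_def)
  qed
  then show ?thesis
    by (simp add: strongly_connected_def simple_digraph_def)
qed

section \<open>SL2, its quotient PSL2 and the lifting of the Engel graphs\<close>

lemma group_SL2: "group (SL2 :: ('a::field ^ 2 ^ 2) monoid)"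
proof (rule groupI)
  fix A :: "'a ^ 2 ^ 2" assume "A \<in> carrier SL2"
  then show "\<exists>B\<in>carrier SL2. B \<otimes>\<^bsub>SL2\<^esub> A = \<one>\<^bsub>SL2\<^esub>"
    by (intro bexI[of _ "adj2 A"]) (simp_all add: SL2_def adj2_left)
qed (simp_all add: SL2_def det_mul matrix_mul_assoc)

lemma SL2_simps [simp]:
  "A \<in> carrier SL2 \<longleftrightarrow> det A = 1" "A \<otimes>\<^bsub>SL2\<^esub> B = A ** B" "\<one>\<^bsub>SL2\<^esub> = mat 1"
  by (simp_all add: SL2_def)

lemma inv_SL2: "det A = 1 \<Longrightarrow> inv\<^bsub>SL2\<^esub> A = adj2 A"
  using group.inv_equality[OF group_SL2, of "adj2 A" A] by (simp add: adj2_left)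

lemma engel_comm_SL2: "det A = 1 \<Longrightarrow> det B = 1 \<Longrightarrow> engel_comm SL2 A n B = sl2_engel A n B"
  by (induction n) (simp_all add: group_comm_def inv_SL2)

definition psl :: "'a::field ^ 2 ^ 2 \<Rightarrow> ('a ^ 2 ^ 2) set" where
  "psl A = group_center SL2 #>\<^bsub>SL2\<^esub> A"

lemma group_hom_psl: "group_hom SL2 PSL2 psl"
proof -
  interpret Z: normal "group_center SL2" "SL2 :: ('a::field ^ 2 ^ 2) monoid"
    by (rule group.group_center_normal[OF group_SL2])
  have "psl = (\<lambda>A :: 'a ^ 2 ^ 2. group_center SL2 #>\<^bsub>SL2\<^esub> A)"
    by (simp add: psl_def fun_eq_iff)
  then show ?thesis
    using Z.r_coset_hom_Mod Z.factorgroup_is_group group_SL2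
    by (simp add: group_hom_def group_hom_axioms_def PSL2_def)
qed

lemma carrier_PSL2: "carrier PSL2 = psl ` {A. det A = 1}"
  by (auto simp: PSL2_def FactGroup_def RCOSETS_def psl_def SL2_def)

context
  assumes two: "(2::'a::field) \<noteq> 0"
begin

lemma group_center_SL2: "group_center SL2 = {mat 1, - mat 1 :: 'a ^ 2 ^ 2}"
proof (intro equalityI subsetI)
  fix A :: "'a ^ 2 ^ 2" assume "A \<in> group_center SL2"
  then have A: "det A = 1" "\<And>B. det B = 1 \<Longrightarrow> A ** B = B ** A"
    by (auto simp: group_center_def)
  show "A \<in> {mat 1, - mat 1}"
  proof (cases A rule: mat2_cases)
    case (mat2 a b c d)
    have "commutes A (mat2 1 1 0 1)" "commutes A (mat2 1 0 1 1)"
      using A(2) by (simp_all add: commutes_def)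
    then have "b = 0" "c = 0" "a = d"
      by (simp_all add: mat2 commutes_mat2_iff)
    then show ?thesis
      using A(1) square_eq_1_iff[of d] by (auto simp: mat2 mat_eq_mat2)
  qed
next
  fix A :: "'a ^ 2 ^ 2" assume "A \<in> {mat 1, - mat 1}"
  moreover have "det (- mat 1 :: 'a ^ 2 ^ 2) = 1"
    by (simp add: mat_eq_mat2)
  ultimately show "A \<in> group_center SL2"
    by (auto simp: group_center_def mult_uminus_left2 mult_uminus_right2)
qed

lemma psl_eq: "psl (A :: 'a ^ 2 ^ 2) = {A, - A}"
  by (simp add: psl_def r_coset_def group_center_SL2 mult_uminus_left2 insert_commute)

lemma psl_eq_iff: "psl (A :: 'a ^ 2 ^ 2) = psl B \<longleftrightarrow> A = B \<or> A = - B"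
  by (auto simp: psl_eq doubleton_eq_iff)

lemma one_PSL2: "\<one>\<^bsub>PSL2\<^esub> = psl (mat 1 :: 'a ^ 2 ^ 2)"
  by (simp add: PSL2_def FactGroup_def psl_eq group_center_SL2)

lemma psl_eq_one_iff: "psl (A :: 'a ^ 2 ^ 2) = \<one>\<^bsub>PSL2\<^esub> \<longleftrightarrow> pm_one A"
  by (simp add: one_PSL2 psl_eq_iff pm_one_def)

lemma engel_comm_PSL2_eq_one_iff:
  assumes "det (A :: 'a ^ 2 ^ 2) = 1" "det B = 1"
  shows "engel_comm PSL2 (psl A) n (psl B) = \<one>\<^bsub>PSL2\<^esub> \<longleftrightarrow> pm_one (sl2_engel A n B)"
  using engel_comm_hom(2)[OF group_hom_psl, of A B n] assms
  by (simp add: engel_comm_SL2 psl_eq_one_iff)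

lemma carrier_PSL2_minus_one: "carrier PSL2 - {\<one>\<^bsub>PSL2\<^esub>} = psl ` {A :: 'a ^ 2 ^ 2. noncentral A}"
  unfolding carrier_PSL2 noncentral_def using psl_eq_one_iff by blast

text \<open>The set N of admissible exponents covers both graphs: a singleton for the n-th Engel
  graph, all positive numbers for the Engel graph.\<close>

lemma strongly_connected_PSL2_iff:
  assumes "N \<noteq> {}" "0 \<notin> N"
  shows "strongly_connected (simple_digraph (carrier PSL2 - {\<one>\<^bsub>PSL2\<^esub>})
        (\<lambda>x y :: ('a ^ 2 ^ 2) set. \<exists>n\<in>N. engel_comm PSL2 x n y = \<one>\<^bsub>PSL2\<^esub>)) \<longleftrightarrow>
      (\<forall>A B :: 'a ^ 2 ^ 2. noncentral A \<longrightarrow> noncentral B \<longrightarrow> (\<lambda>A B. \<exists>n\<in>N. sl2_arc n A B)\<^sup>*\<^sup>* A B)"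
    (is "?L \<longleftrightarrow> ?R")
proof -
  let ?V = "psl ` {A :: 'a ^ 2 ^ 2. noncentral A}"
  let ?P = "\<lambda>x y. x \<in> ?V \<and> y \<in> ?V \<and> (\<exists>n\<in>N. engel_comm PSL2 x n y = \<one>\<^bsub>PSL2\<^esub>)"
  let ?Q = "\<lambda>A B :: 'a ^ 2 ^ 2. \<exists>n\<in>N. sl2_arc n A B"
  have PQ: "?P (psl A) (psl B) \<longleftrightarrow> ?Q A B" if "noncentral A" "noncentral B" for A B
  proof -
    have "det A = 1" "det B = 1"
      using that by (simp_all add: noncentral_def)
    then show ?thesis
      using that by (simp add: sl2_arc_def engel_comm_PSL2_eq_one_iff)
  qed
  \<comment> \<open>Two representatives of one vertex commute and are joined by an arc, so lifting a
    path does not depend on the chosen signs.\<close>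
  have same: "?Q A B" if "noncentral A" "noncentral B" "psl A = psl B" for A B
  proof -
    obtain n where "n \<in> N" "n \<ge> 1"
      using assms by (metis One_nat_def Suc_leI all_not_in_conv not_gr_zero)
    moreover have "commutes A B"
      using that(3) by (auto simp: psl_eq_iff commutes_def mult_uminus_left2 mult_uminus_right2)
    ultimately show ?thesis
      using that sl2_arc_commutes by blast
  qed
  have to: "?Q\<^sup>*\<^sup>* A B" if "?P\<^sup>*\<^sup>* (psl A) (psl B)" "noncentral A" "noncentral B" for A B
  proof -
    have "\<forall>B. noncentral B \<longrightarrow> v = psl B \<longrightarrow> ?Q\<^sup>*\<^sup>* A B" if "?P\<^sup>*\<^sup>* (psl A) v" for v
      using that
    proof (induction rule: rtranclp_induct)
      case base
      then show ?case
        using same[OF \<open>noncentral A\<close>] by blast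
    next
      case (step v w)
      then obtain C where C: "noncentral C" "v = psl C" "?Q\<^sup>*\<^sup>* A C"
        by blast
      show ?case
      proof (intro allI impI)
        fix B :: "'a ^ 2 ^ 2" assume B: "noncentral B" "w = psl B"
        then have "?Q C B"
          using PQ[OF C(1) B(1)] step.hyps(2) C(2) by simp
        with C(3) show "?Q\<^sup>*\<^sup>* A B"
          by (rule rtranclp.rtrancl_into_rtrancl)
      qed
    qed
    from this[OF that(1)] that(3) show ?thesis
      by simp
  qed
  have from_sl: "?P\<^sup>*\<^sup>* (psl A) (psl B)" if "?Q\<^sup>*\<^sup>* A B" for A B
    using that
  proof (induction rule: rtranclp_induct)
    case (step B C)
    then have "noncentral B" "noncentral C"
      by (auto simp: sl2_arc_def)
    then have "?P (psl B) (psl C)"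
      using PQ[of B C] step.hyps(2) by simp
    with step.IH show ?case
      by (rule rtranclp.rtrancl_into_rtrancl)
  qed simp
  have "noncentral (mat2 1 1 0 1 :: 'a ^ 2 ^ 2)"
    by (rule noncentral_unipotent) simp_all
  then have "?V \<noteq> {}"
    by blast
  have "(\<forall>u\<in>?V. \<forall>v\<in>?V. ?P\<^sup>*\<^sup>* u v) \<longleftrightarrow> ?R"
  proof (rule iffI; intro allI impI ballI)
    fix A B :: "'a ^ 2 ^ 2"
    assume "\<forall>u\<in>?V. \<forall>v\<in>?V. ?P\<^sup>*\<^sup>* u v" "noncentral A" "noncentral B"
    then show "?Q\<^sup>*\<^sup>* A B"
      by (intro to) simp_all
  next
    fix u v assume R: ?R and uv: "u \<in> ?V" "v \<in> ?V"
    then obtain A B where "u = psl A" "v = psl B" "noncentral A" "noncentral B"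
      by blast
    then show "?P\<^sup>*\<^sup>* u v"
      using from_sl R by simp
  qed
  with \<open>?V \<noteq> {}\<close> show ?thesis
    unfolding carrier_PSL2_minus_one strongly_connected_simple_digraph_iff by (simp only: simp_thms)
qed

lemma engel_isolated_PSL2:
  assumes n: "n \<ge> 1" and ex: "\<And>A :: 'a ^ 2 ^ 2. noncentral A \<Longrightarrow> \<exists>B. noncentral B \<and> (\<forall>n. \<not> pm_one (sl2_engel A n B))"
  shows "engel_isolated (PSL2 :: ('a ^ 2 ^ 2) set monoid) n = {\<one>\<^bsub>PSL2\<^esub>}"
proof (intro equalityI subsetI)
  fix g :: "('a ^ 2 ^ 2) set" assume g: "g \<in> engel_isolated PSL2 n"
  then obtain A where A: "det A = 1" "g = psl A"
    by (auto simp: engel_isolated_def carrier_PSL2)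
  have "pm_one A"
  proof (rule ccontr)
    assume "\<not> pm_one A"
    then obtain B where B: "noncentral B" "\<not> pm_one (sl2_engel A n B)"
      using ex A(1) by (auto simp: noncentral_def)
    then have "det B = 1"
      by (simp add: noncentral_def)
    then have "engel_comm PSL2 (psl A) n (psl B) = \<one>\<^bsub>PSL2\<^esub>"
      using g A(2) by (auto simp: engel_isolated_def carrier_PSL2)
    then show False
      using engel_comm_PSL2_eq_one_iff[OF A(1) \<open>det B = 1\<close>] B(2) by simp
  qed
  then show "g \<in> {\<one>\<^bsub>PSL2\<^esub>}"
    using A(2) psl_eq_one_iff by simp
next
  fix g :: "('a ^ 2 ^ 2) set" assume "g \<in> {\<one>\<^bsub>PSL2\<^esub>}"
  then have g: "g = psl (mat 1)"
    by (simp add: one_PSL2)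
  have "pm_one (sl2_engel A n (mat 1))" "pm_one (sl2_engel (mat 1) n A)" if "det A = 1" for A :: "'a ^ 2 ^ 2"
  proof -
    have "pm_one (sl2_engel A 1 (mat 1))"
      using that by (simp add: pm_one_def adj2_left)
    then show "pm_one (sl2_engel A n (mat 1))"
      using n by (rule pm_one_sl2_engel_mono) simp
    have "pm_one (sl2_engel (mat 1) 0 A)"
      by (simp add: pm_one_def)
    then show "pm_one (sl2_engel (mat 1) n A)"
      using that by (rule pm_one_sl2_engel_mono[OF _ le0])
  qed
  then show "g \<in> engel_isolated PSL2 n"
    using engel_comm_PSL2_eq_one_iff by (auto simp: engel_isolated_def carrier_PSL2 g)
qed

lemma hypercenter_PSL2:
  assumes ex: "\<And>A :: 'a ^ 2 ^ 2. noncentral A \<Longrightarrow> \<exists>B. noncentral B \<and> (\<forall>n. \<not> pm_one (sl2_engel A n B))"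
  shows "hypercenter (PSL2 :: ('a ^ 2 ^ 2) set monoid) = {\<one>\<^bsub>PSL2\<^esub>}"
proof -
  interpret group_hom SL2 PSL2 "psl :: 'a ^ 2 ^ 2 \<Rightarrow> _"
    by (rule group_hom_psl)
  show ?thesis
  proof (rule H.hypercenter_trivial, intro equalityI subsetI)
    fix g assume g: "g \<in> group_center (PSL2 :: ('a ^ 2 ^ 2) set monoid)"
    then obtain A where A: "det A = 1" "g = psl A"
      by (auto simp: group_center_def carrier_PSL2)
    have "pm_one A"
    proof (rule ccontr)
      assume "\<not> pm_one A"
      then obtain B where B: "noncentral B" "\<And>n. \<not> pm_one (sl2_engel A n B)"
        using ex[of A] A(1) unfolding noncentral_def by blast
      then have dB: "det B = 1"
        by (simp add: noncentral_def)
      then have "psl A \<otimes>\<^bsub>PSL2\<^esub> psl B = psl B \<otimes>\<^bsub>PSL2\<^esub> psl A"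
        using g A(2) by (auto simp: group_center_def carrier_PSL2)
      then have "psl (A ** B) = psl (B ** A)"
        using hom_mult[of A B] hom_mult[of B A] A(1) dB by simp
      then have "pm_one (sl2_engel A 1 B)"
        using pm_one_sl2_engel_one_iff[OF A(1) dB] by (simp add: psl_eq_iff commutes_def)
      then show False
        using B(2) by blast
    qed
    then show "g \<in> {\<one>\<^bsub>PSL2\<^esub>}"
      using A(2) psl_eq_one_iff by simp
  qed (auto simp: group_center_def)
qed

end

lemma rtranclp_invariant:
  assumes "R\<^sup>*\<^sup>* a b" "P a" "\<And>x y. P x \<Longrightarrow> R x y \<Longrightarrow> P y"
  shows "P b"
  using assms(1,2) by (induction rule: rtranclp_induct) (auto intro: assms(3))

section \<open>Strong connectivity according to the residue of q\<close>

context
  assumes pp: "primepow CARD('a::{field,finite})" and odd_card: "odd CARD('a)"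
begin

lemma two_neq_0: "(2::'a) \<noteq> 0"
  by (rule two_neq_zero[OF odd_card])

lemma square_if_nonsquares: "\<not> square (x::'a) \<Longrightarrow> \<not> square y \<Longrightarrow> square (x * y)"
  using square_mult_iff[OF odd_card, of x y] square_power2[of "0::'a"] by (cases "x = 0"; cases "y = 0") auto

lemma nth_engel_graph_PSL2_iff:
  assumes "n \<ge> 1"
  shows "strongly_connected (nth_engel_graph (PSL2 :: ('a ^ 2 ^ 2) set monoid) n) \<longleftrightarrow>
    (\<forall>A B :: 'a ^ 2 ^ 2. noncentral A \<longrightarrow> noncentral B \<longrightarrow> sl2_reach n A B)"
  using strongly_connected_PSL2_iff[OF two_neq_0, of "{n}"] assms
    engel_isolated_PSL2[OF two_neq_0 assms ex_not_engel[OF two_neq_0]]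
  by (simp add: nth_engel_graph_def)

lemma engel_graph_PSL2_iff:
  "strongly_connected (engel_graph (PSL2 :: ('a ^ 2 ^ 2) set monoid)) \<longleftrightarrow>
    (\<forall>A B :: 'a ^ 2 ^ 2. noncentral A \<longrightarrow> noncentral B \<longrightarrow> (\<lambda>A B. \<exists>n\<in>{0<..}. sl2_arc n A B)\<^sup>*\<^sup>* A B)"
  using strongly_connected_PSL2_iff[OF two_neq_0, of "{0<..}"]
    hypercenter_PSL2[OF two_neq_0 ex_not_engel[OF two_neq_0]]
  by (simp add: engel_graph_def Bex_def)

lemma unipotents_closed_not_connected:
  fixes N :: "nat set"
  assumes none: "\<And>n i d :: 'a. n \<in> N \<Longrightarrow> Suc i < max n 2 \<Longrightarrow> (trace_sq ^^ i) (2 + d ^ 2) \<noteq> 0"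
  shows "\<not> (\<forall>A B :: 'a ^ 2 ^ 2. noncentral A \<longrightarrow> noncentral B \<longrightarrow> (\<lambda>A B. \<exists>n\<in>N. sl2_arc n A B)\<^sup>*\<^sup>* A B)"
proof
  assume *: "\<forall>A B :: 'a ^ 2 ^ 2. noncentral A \<longrightarrow> noncentral B \<longrightarrow> (\<lambda>A B. \<exists>n\<in>N. sl2_arc n A B)\<^sup>*\<^sup>* A B"
  let ?P = "\<lambda>A :: 'a ^ 2 ^ 2. \<exists>e s. e ^ 2 = 1 \<and> s \<noteq> 0 \<and> A = mat2 e s 0 e"
  have "noncentral (mat2 1 1 0 1 :: 'a ^ 2 ^ 2)"
    by (rule noncentral_unipotent) simp_all
  moreover have "noncentral (mat2 0 1 (- 1) 0 :: 'a ^ 2 ^ 2)"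
    by (simp add: noncentral_def pm_one_def mat_eq_mat2)
  ultimately have "(\<lambda>A B. \<exists>n\<in>N. sl2_arc n A B)\<^sup>*\<^sup>* (mat2 1 1 0 1 :: 'a ^ 2 ^ 2) (mat2 0 1 (- 1) 0)"
    using * by blast
  then have "?P (mat2 0 1 (- 1) 0)"
  proof (rule rtranclp_invariant)
    show "?P (mat2 1 1 0 1)"
      by (intro exI[of _ 1]) simp
    fix A B :: "'a ^ 2 ^ 2" assume "?P A" "\<exists>n\<in>N. sl2_arc n A B"
    then obtain e s n where es: "e ^ 2 = 1" "s \<noteq> 0" "A = mat2 e s 0 e" and n: "n \<in> N" "sl2_arc n A B"
      by blast
    \<comment> \<open>An arc for n = 1 is also one for 2, where the analysis of unipotents
      applies.\<close>
    have "sl2_arc (max n 2) (mat2 e s 0 e) B"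
      using n es by (auto intro: sl2_arc_mono)
    then show "?P B"
      using sl2_arc_from_unipotent[OF two_neq_0 es(1,2), of "max n 2" B] none[OF n(1)] by simp
  qed
  then show False
    by auto
qed

lemma connected_iff_mod_4_eq_3:
  assumes q: "CARD('a) mod 4 = 3" "CARD('a) \<noteq> 3" and n2: "n \<ge> 2"
  shows "strongly_connected (nth_engel_graph (PSL2 :: ('a ^ 2 ^ 2) set monoid) n) \<longleftrightarrow>
    n > multiplicity 2 ((CARD('a) + 1) div 2)"
proof -
  have m1: "\<not> square (- 1 :: 'a)"
    using square_minus_one_iff[OF odd_card] q by simp
  \<comment> \<open>A noncentral split torus element requires q > 3. For q = 3 the group is A4, and
    no arc leads from its normal four-group to an element of order 3.\<close>
  have "card {0, 1, - 1 :: 'a} \<le> 3"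
    by (simp add: card_insert_if)
  moreover have "CARD('a) > 3"
    using q by presburger
  ultimately have "{0, 1, - 1 :: 'a} \<noteq> UNIV"
    by (metis not_less)
  then obtain r :: 'a where "r \<noteq> 0" "r \<noteq> 1" "r \<noteq> - 1"
    by blast
  then have r: "r \<noteq> 0" "r ^ 2 \<noteq> 1"
    by (auto simp: power2_eq_1_iff)
  obtain i and d :: 'a where d: "(trace_sq ^^ i) (2 + d ^ 2) = 0"
    using ex_trace_sq_iter_zero[where 'a='a] q(1) by blast
  note mult = trace_sq_iter_zero_imp_multiplicity[OF pp q(1)]
  have "strongly_connected (nth_engel_graph (PSL2 :: ('a ^ 2 ^ 2) set monoid) n)" if "Suc i < n"
    using nth_engel_graph_PSL2_iff n2
      sl2_connected_if_not_square_minus_one[OF two_neq_0 m1 square_if_nonsquares r d that] by simp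
  moreover have "\<not> strongly_connected (nth_engel_graph (PSL2 :: ('a ^ 2 ^ 2) set monoid) n)" if "\<not> Suc i < n"
  proof -
    have "(trace_sq ^^ j) (2 + e ^ 2) \<noteq> 0" if "Suc j < max n 2" for j and e :: 'a
      using mult[of j e] mult[OF d] that n2 \<open>\<not> Suc i < n\<close> by auto
    then show ?thesis
      using unipotents_closed_not_connected[of "{n}"] nth_engel_graph_PSL2_iff[of n] n2 by simp
  qed
  ultimately show ?thesis
    unfolding mult[OF d] by blast
qed

lemma connected_if_mod_8_eq_1:
  assumes q: "CARD('a) mod 8 = 1" "CARD('a) \<noteq> 9"
  shows "strongly_connected (nth_engel_graph (PSL2 :: ('a ^ 2 ^ 2) set monoid) 2)"
proof -
  have "CARD('a) \<noteq> 1"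
    using card_mono[of "UNIV :: 'a set" "{0, 1}"] by auto
  then have "CARD('a) > 9"
    using q by presburger
  then obtain t b :: 'a where tb: "\<not> square (t ^ 2 - 4)" "2 - t ^ 2 = b ^ 2"
    using ex_nonsquare_minus_four_square_two_minus[OF odd_card q(1)] by blast
  have "CARD('a) mod 4 = 1"
    using q by presburger
  then obtain i :: 'a where i: "i ^ 2 = - 1"
    using square_minus_one_iff[OF odd_card] by (auto simp: square_def)
  obtain z :: 'a where "2 = z ^ 2"
    using square_two_if_mod_8_eq_1[OF odd_card q(1)] by (auto simp: square_def)
  \<comment> \<open>With both 2 and -1 squares the value 2 + d^2 vanishes before any squaring, so n
    = 2 suffices.\<close>
  then have "2 + (i * z) ^ 2 = 0"
    using i by (simp add: power_mult_distrib)
  from sl2_connected_if_square_minus_one[OF two_neq_0 i this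
      irreducible_reach_involutory[OF two_neq_0 _ _ i tb square_if_nonsquares]]
  show ?thesis
    using nth_engel_graph_PSL2_iff[of 2] by simp
qed

lemma not_connected_if_mod_8_eq_5:
  assumes q: "CARD('a) mod 8 = 5"
  shows "\<not> strongly_connected (engel_graph (PSL2 :: ('a ^ 2 ^ 2) set monoid))"
proof -
  have "CARD('a) mod 4 = 1"
    using q by presburger
  then have m1: "square (- 1 :: 'a)"
    using square_minus_one_iff[OF odd_card] by simp
  have two: "\<not> square (2 :: 'a)"
    by (rule not_square_two_if_mod_8_eq_5[OF odd_card q])
  have "(trace_sq ^^ i) (2 + d ^ 2) \<noteq> 0" for i and d :: 'a
  proof
    assume zero: "(trace_sq ^^ i) (2 + d ^ 2) = 0"
    show False
    proof (cases i)
      case 0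
      then have "2 = - 1 * d ^ 2"
        using zero by (simp add: eq_neg_iff_add_eq_0)
      moreover obtain y :: 'a where "- 1 = y ^ 2"
        using m1 by (auto simp: square_def)
      ultimately have "2 = (y * d) ^ 2"
        by (simp only: power_mult_distrib)
      then show False
        using two by (auto simp: square_def)
    next
      case (Suc j)
      then have "2 = ((trace_sq ^^ j) (2 + d ^ 2)) ^ 2"
        using zero by (simp add: trace_sq_def[of "(trace_sq ^^ j) _"])
      then show False
        using two by (auto simp: square_def)
    qed
  qed
  then show ?thesis
    using unipotents_closed_not_connected[of "{0<..}"] by (simp only: engel_graph_PSL2_iff simp_thms)
qed

section \<open>The field with nine elements\<close>

context
  assumes card9: "CARD('a) = 9"
begin

lemma three_eq_zero: "(3::'a) = 0"
proof -
  have "CHAR('a) dvd 3 ^ 2"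
    using CHAR_dvd_CARD[where 'a='a] card9 by simp
  moreover have "prime CHAR('a)"
    by (rule card_power_CHAR(1)[OF pp])
  ultimately have "CHAR('a) dvd 3"
    using prime_dvd_power by blast
  then show ?thesis
    by (metis of_nat_eq_0_iff_char_dvd of_nat_numeral)
qed

lemma power_4_plus_one: "(x + 1) ^ 4 = x ^ 4 + x ^ 3 + x + (1::'a)"
proof -
  have "(x + 1) ^ 4 = x ^ 4 + x ^ 3 + x + 1 + 3 * (x ^ 3 + 2 * x ^ 2 + x)"
    by (simp add: eval_nat_numeral algebra_simps)
  then show ?thesis
    by (simp add: three_eq_zero)
qed

lemma power_4_eq: "(x::'a) \<noteq> 0 \<Longrightarrow> x ^ 4 = (if square x then 1 else - 1)"
  using euler_criterion_field[OF odd_card, of x] card9 by simp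

lemma one_neq_minus_one: "(1::'a) \<noteq> - 1"
  using two_neq_0 by (simp add: eq_neg_iff_add_eq_0)

lemma square_minus_one_card_9: "square (- 1 :: 'a)"
  using square_minus_one_iff[OF odd_card] card9 by simp

text \<open>Fourth powers are the quadratic character here, and 4 = 1. For t nonzero, (t^2 - 1)^4 =
  -1 - t^2 (t^4 + 1), so the irreducible traces are exactly the nonsquares.\<close>

lemma nonsquare_minus_four_iff: "\<not> square (t ^ 2 - 4 :: 'a) \<longleftrightarrow> t ^ 4 = - 1"
proof -
  have "t ^ 2 - 4 = t ^ 2 - 1 - (3::'a)"
    by simp
  then have eq: "t ^ 2 - 4 = t ^ 2 - (1::'a)"
    by (simp only: three_eq_zero diff_zero)
  consider "t = 0" | "t ^ 2 = 1" | "t \<noteq> 0" "t ^ 2 - 1 \<noteq> 0"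
    by auto
  then show ?thesis
  proof cases
    case 1
    then show ?thesis
      using square_minus_one_card_9 unfolding eq by simp
  next
    case 2
    then have "t ^ 4 = 1"
      by (metis mult_2 numeral_Bit0 one_power2 power2_eq_square power_add)
    then show ?thesis
      using 2 one_neq_minus_one square_power2[of "0::'a"] unfolding eq by simp
  next
    case 3
    have t8: "t ^ 8 = 1"
      using finite_field_power_pred[OF 3(1)] card9 by simp
    have "(t ^ 2 - 1) ^ 4 = (- (t ^ 2) + 1) ^ 4"
      by (metis minus_diff_eq power_minus_even even_numeral uminus_add_conv_diff add.commute
        diff_conv_add_uminus)
    also have "\<dots> = t ^ 8 - t ^ 6 - t ^ 2 + 1"
      unfolding power_4_plus_one by (simp flip: power_mult)
    also have "\<dots> = - 1 + 3 - t ^ 2 * (t ^ 4 + 1)"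
      unfolding t8 by (simp add: eval_nat_numeral algebra_simps)
    also have "\<dots> = - 1 - t ^ 2 * (t ^ 4 + 1)"
      by (simp only: three_eq_zero add_0_right)
    finally have "(t ^ 2 - 1) ^ 4 = - 1 - t ^ 2 * (t ^ 4 + 1)" .
    then have "(t ^ 2 - 1) ^ 4 = - 1 \<longleftrightarrow> t ^ 4 + 1 = 0"
      using 3(1) by simp
    then show ?thesis
      unfolding eq using power_4_eq[OF 3(2)] one_neq_minus_one
      by (auto simp: eq_neg_iff_add_eq_0 split: if_splits)
  qed
qed

text \<open>In characteristic 3, 2 - t^2 = -(t^2 + 1), whose fourth power is t^8 + t^6 + t^2 + 1 =
  -1 when t^4 = -1. So irreducible matrices have no escape for n = 2.\<close>

lemma two_minus_power2_not_power2:
  assumes "t ^ 4 = - (1::'a)"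
  shows "2 - t ^ 2 \<noteq> b ^ 2"
proof
  assume b: "2 - t ^ 2 = b ^ 2"
  have "2 - t ^ 2 = 3 - (t ^ 2 + (1::'a))"
    by simp
  then have "b ^ 2 = - (t ^ 2 + 1)"
    unfolding b by (simp only: three_eq_zero diff_0)
  then have "(b ^ 2) ^ 4 = (t ^ 2 + 1) ^ 4"
    by (simp only: power_minus_even even_numeral)
  also have "\<dots> = (t ^ 4) ^ 2 + t ^ 4 * t ^ 2 + t ^ 2 + 1"
    unfolding power_4_plus_one by (simp flip: power_mult power_add)
  also have "\<dots> = - 1 + 3"
    unfolding assms by simp
  finally have "(b ^ 2) ^ 4 = - 1"
    by (simp only: three_eq_zero add_0_right)
  moreover from this have "b ^ 2 \<noteq> 0"
    by auto
  ultimately show False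
    using power_4_eq[of "b ^ 2"] one_neq_minus_one by simp
qed

lemma connected_iff_card_9:
  assumes "n \<ge> 2"
  shows "strongly_connected (nth_engel_graph (PSL2 :: ('a ^ 2 ^ 2) set monoid) n) \<longleftrightarrow> n \<ge> 3"
proof
  assume "n \<ge> 3"
  obtain i :: 'a where i: "i ^ 2 = - 1"
    using square_minus_one_card_9 by (auto simp: square_def)
  \<comment> \<open>Unipotents can leave with d = 1 since 3 = 0.\<close>
  have d: "2 + 1 ^ 2 = (0::'a)"
    using three_eq_zero by simp
  have irr: "\<exists>Y. involutory Y \<and> sl2_reach n A Y"
    if A: "det A = 1" "\<not> square ((trace A) ^ 2 - 4)" for A :: "'a ^ 2 ^ 2"
  proof -
    \<comment> \<open>Product trace \<open>i\<close> gives the commutator trace t^2 - 3 = t^2, and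
      one squaring gives t^4 - 2 = -3 = 0. That one iteration is why n = 3 is needed.\<close>
    obtain y where Y: "involutory (mat2 i y 0 (- i))" "trace (A ** mat2 i y 0 (- i)) = i"
      using ex_involutory_trace_mult[OF two_neq_0 A(2,1) i] by blast
    have "\<not> pm_one A"
      using A(2) square_power2[of "0::'a"] by (auto simp: pm_one_def mat_eq_mat2)
    then have "noncentral A"
      using A(1) by (simp add: noncentral_def)
    have "(trace A) ^ 2 + i ^ 2 - 2 = (trace A) ^ 2 - 3"
      by (simp add: i)
    also have "\<dots> = (trace A) ^ 2"
      by (simp only: three_eq_zero diff_zero)
    finally have "(trace_sq ^^ 1) ((trace A) ^ 2 + (trace (A ** mat2 i y 0 (- i))) ^ 2 - 2) = trace A ^ 4 - 2"
      unfolding Y(2) by (simp add: trace_sq_def flip: power_mult)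
    also have "\<dots> = - 3"
      using A(2) by (simp add: nonsquare_minus_four_iff)
    finally have "sl2_arc n A (mat2 i y 0 (- i))"
      using \<open>n \<ge> 3\<close> by (intro sl2_arc_to_involutory[OF two_neq_0 \<open>noncentral A\<close> Y(1), of 1])
        (simp_all only: three_eq_zero minus_zero)
    then show ?thesis
      using Y(1) by blast
  qed
  show "strongly_connected (nth_engel_graph (PSL2 :: ('a ^ 2 ^ 2) set monoid) n)"
    using sl2_connected_if_square_minus_one[OF two_neq_0 i d irr assms] nth_engel_graph_PSL2_iff[of n] assms
    by simp
next
  assume sc: "strongly_connected (nth_engel_graph (PSL2 :: ('a ^ 2 ^ 2) set monoid) n)"
  show "n \<ge> 3"
  proof (rule ccontr)
    assume "\<not> n \<ge> 3"
    then have n: "n = 2"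
      using assms by simp
    obtain t :: 'a where t: "\<not> square t"
      using ex_nonsquare[OF odd_card] by blast
    then have "t \<noteq> 0"
      using square_power2[of "0::'a"] by auto
    then have irr: "\<not> square (t ^ 2 - 4)"
      using power_4_eq t by (simp add: nonsquare_minus_four_iff)
    \<comment> \<open>The companion matrix of an irreducible polynomial with trace \<open>t\<close>;
      its centralizer is the trap for n = 2.\<close>
    define g where "g = mat2 0 (- 1) 1 t"
    have g: "\<not> square ((trace g) ^ 2 - 4)" "det g = 1"
      using irr by (simp_all add: g_def)
    have "noncentral g"
      by (simp add: g_def noncentral_def pm_one_def mat_eq_mat2)
    moreover have U: "noncentral (mat2 1 1 0 1 :: 'a ^ 2 ^ 2)"
      by (rule noncentral_unipotent) simp_all
    ultimately have "sl2_reach 2 g (mat2 1 1 0 1)"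
      using sc nth_engel_graph_PSL2_iff[of 2] n by simp
    then have "commutes g (mat2 1 1 0 1)"
    proof (rule rtranclp_invariant)
      show "commutes g g"
        by (simp add: commutes_def)
      show "commutes g B" if "commutes g A" "sl2_arc 2 A B" for A B
        using sl2_arc_from_irreducible[OF two_neq_0 g that square_minus_one_card_9]
          two_minus_power2_not_power2 nonsquare_minus_four_iff by blast
    qed
    from commutes_irreducible(1)[OF two_neq_0 g U this] show False
      using square_power2[of "0::'a"] by simp
  qed
qed

end

end

theorem theorem3p8:
  fixes q n :: nat and G :: "('a::{field,finite} ^ 2 ^ 2) set monoid"
  assumes "primepow q" and "odd q" and "CARD('a) = q"
    and "G = PSL2" and "n \<ge> 2"
  shows "(q mod 4 = 3 \<and> q \<noteq> 3 \<longrightarrow>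
           (strongly_connected (nth_engel_graph G n) \<longleftrightarrow>
            n > multiplicity 2 ((q + 1) div 2))) \<and>
         (q mod 8 = 1 \<and> q \<noteq> 9 \<longrightarrow>
           strongly_connected (nth_engel_graph G 2)) \<and>
         (q = 9 \<longrightarrow>
           (strongly_connected (nth_engel_graph G n) \<longleftrightarrow> n \<ge> 3)) \<and>
         (q mod 8 = 5 \<longrightarrow> \<not> strongly_connected (engel_graph G))"
proof -
  have q: "primepow CARD('a)" "odd CARD('a)"
    using assms by simp_all
  note facts = connected_iff_mod_4_eq_3[OF q _ _ \<open>n \<ge> 2\<close>] connected_if_mod_8_eq_1[OF q]
    connected_iff_card_9[OF q _ \<open>n \<ge> 2\<close>] not_connected_if_mod_8_eq_5[OF q]
  show ?thesis
    using facts unfolding \<open>G = PSL2\<close> \<open>CARD('a) = q\<close> by blast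
qed

end
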